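(* There is an algorithm in the $KT_0$-\textsc{Congest} model that solves \textsc{SetCover} in time $O(\log^2(\Delta))$ with expected approximation ratio $O(\log(\Delta))$. With high probability it sends only $\tilde{O}(\sqrt{\Delta}(n+m))$ messages. This holds provided all nodes know $\Delta$ and an approximation of $\log(n)$.
   Context: \textsc{SetCover}: given a ground set of elements and a family of subsets, find a minimum number of subsets whose union is the ground set. There are $n$ and $m$ nodes on the two sides: the sets and the elements. Communication graph: $G=(V_{\mathcal{S}}\cup V_{\mathcal{U}},E)$, bipartite, with a bidirected edge between each set and each element it contains. $\Delta$ is the maximum degree of $G$. $KT_0$-\textsc{Congest} model: computation proceeds in synchronous rounds, and all nodes wake up in the same round. Nodes distinguish their incident edges only through local port numbers; there are no global identifiers and nodes initially do not know their neighbors' identities. In each round a node may send a distinct message of $O(\log n)$ bits to any subset of its neighbors, and messages are received in the next round. The message complexity is the total number of messages sent. $\tilde{O}$ hides polylogarithmic factors. "With high probability" means with probability at least $1-n^{-c}$ for a constant $c>0$. *)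

theory Defs
  imports "HOL-Probability.Probability"
begin

definition is_cover :: "(nat \<Rightarrow> nat \<Rightarrow> bool) \<Rightarrow> nat \<Rightarrow> nat \<Rightarrow> nat set \<Rightarrow> bool" where
  "is_cover mem n m C \<longleftrightarrow> C \<subseteq> {..<n} \<and> (\<forall>j<m. \<exists>i\<in>C. mem i j)"

definition opt_cover :: "(nat \<Rightarrow> nat \<Rightarrow> bool) \<Rightarrow> nat \<Rightarrow> nat \<Rightarrow> nat" where
  "opt_cover mem n m = Min (card ` {C. is_cover mem n m C})"

datatype node = SNode nat | ENode nat

definition nodes :: "nat \<Rightarrow> nat \<Rightarrow> node set" where
  "nodes n m = SNode ` {..<n} \<union> ENode ` {..<m}"

fun adj :: "(nat \<Rightarrow> nat \<Rightarrow> bool) \<Rightarrow> nat \<Rightarrow> nat \<Rightarrow> node \<Rightarrow> node \<Rightarrow> bool" where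
  "adj mem n m (SNode i) (ENode j) = (i < n \<and> j < m \<and> mem i j)"
| "adj mem n m (ENode j) (SNode i) = (i < n \<and> j < m \<and> mem i j)"
| "adj mem n m _ _ = False"

definition nbrs :: "(nat \<Rightarrow> nat \<Rightarrow> bool) \<Rightarrow> nat \<Rightarrow> nat \<Rightarrow> node \<Rightarrow> node set" where
  "nbrs mem n m v = {u. adj mem n m v u}"

definition deg :: "(nat \<Rightarrow> nat \<Rightarrow> bool) \<Rightarrow> nat \<Rightarrow> nat \<Rightarrow> node \<Rightarrow> nat" where
  "deg mem n m v = card (nbrs mem n m v)"

definition maxdeg :: "(nat \<Rightarrow> nat \<Rightarrow> bool) \<Rightarrow> nat \<Rightarrow> nat \<Rightarrow> nat" where
  "maxdeg mem n m = Max (deg mem n m ` nodes n m)"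

text \<open>KT0 port numbering: each node v sees its incident edges only through
  local ports 0..<deg v; pn v p is the neighbour behind port p.
  Port numberings are arbitrary (adversarial).\<close>
definition port_numbering :: "(nat \<Rightarrow> nat \<Rightarrow> bool) \<Rightarrow> nat \<Rightarrow> nat \<Rightarrow> (node \<Rightarrow> nat \<Rightarrow> node) \<Rightarrow> bool" where
  "port_numbering mem n m pn \<longleftrightarrow>
     (\<forall>v\<in>nodes n m. bij_betw (pn v) {..<deg mem n m v} (nbrs mem n m v))"

definition bport :: "(nat \<Rightarrow> nat \<Rightarrow> bool) \<Rightarrow> nat \<Rightarrow> nat \<Rightarrow> (node \<Rightarrow> nat \<Rightarrow> node) \<Rightarrow> node \<Rightarrow> node \<Rightarrow> nat" where
  "bport mem n m pn u v = (THE p. p < deg mem n m u \<and> pn u p = v)"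

text \<open>Local input of a node: (is it a set node?, its degree, Delta, L) where L is the
  approximation of log n known to all nodes. Nothing else (no identifiers).\<close>
type_synonym linput = "bool \<times> nat \<times> nat \<times> nat"

text \<open>Messages are bit strings; None = no message on that port.
  A local history is the list (one entry per past round) of received messages per port.
  A random tape is an infinite sequence of bits.\<close>
type_synonym message = "bool list"
type_synonym history = "(nat \<Rightarrow> message option) list"
type_synonym tape = "nat \<Rightarrow> bool"

text \<open>A (uniform, randomized) algorithm in full-information form: the number of rounds
  as a function of (Delta, L); the message a node sends on a port in the next round as a
  function of its local input, random tape, history and the port; and the final output
  (for set nodes: whether the set joins the cover). Local computation is unbounded.\<close>
record alg =
  rounds :: "nat \<Rightarrow> nat \<Rightarrow> nat"
  send :: "linput \<Rightarrow> tape \<Rightarrow> history \<Rightarrow> nat \<Rightarrow> message option"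
  outp :: "linput \<Rightarrow> tape \<Rightarrow> history \<Rightarrow> bool"

definition linp :: "(nat \<Rightarrow> nat \<Rightarrow> bool) \<Rightarrow> nat \<Rightarrow> nat \<Rightarrow> nat \<Rightarrow> node \<Rightarrow> linput" where
  "linp mem n m L v = ((case v of SNode _ \<Rightarrow> True | ENode _ \<Rightarrow> False),
                       deg mem n m v, maxdeg mem n m, L)"

fun hist :: "alg \<Rightarrow> (nat \<Rightarrow> nat \<Rightarrow> bool) \<Rightarrow> nat \<Rightarrow> nat \<Rightarrow> (node \<Rightarrow> nat \<Rightarrow> node) \<Rightarrow> nat
             \<Rightarrow> (node \<Rightarrow> tape) \<Rightarrow> nat \<Rightarrow> node \<Rightarrow> history" where
  "hist A mem n m pn L tp 0 v = []"
| "hist A mem n m pn L tp (Suc r) v =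
     hist A mem n m pn L tp r v @
     [(\<lambda>q. if q < deg mem n m v then
             send A (linp mem n m L (pn v q)) (tp (pn v q)) (hist A mem n m pn L tp r (pn v q))
                    (bport mem n m pn (pn v q) v)
           else None)]"

definition sent :: "alg \<Rightarrow> (nat \<Rightarrow> nat \<Rightarrow> bool) \<Rightarrow> nat \<Rightarrow> nat \<Rightarrow> (node \<Rightarrow> nat \<Rightarrow> node) \<Rightarrow> nat
             \<Rightarrow> (node \<Rightarrow> tape) \<Rightarrow> (nat \<times> node \<times> nat) set" where
  "sent A mem n m pn L tp =
     {(r, v, p). r < rounds A (maxdeg mem n m) L \<and> v \<in> nodes n m \<and> p < deg mem n m v \<and>
        send A (linp mem n m L v) (tp v) (hist A mem n m pn L tp r v) p \<noteq> None}"

definition msg_size_ok :: "alg \<Rightarrow> (nat \<Rightarrow> nat \<Rightarrow> bool) \<Rightarrow> nat \<Rightarrow> nat \<Rightarrow> (node \<Rightarrow> nat \<Rightarrow> node) \<Rightarrow> nat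
             \<Rightarrow> real \<Rightarrow> bool" where
  "msg_size_ok A mem n m pn L c \<longleftrightarrow>
     (\<forall>tp r v p b. r < rounds A (maxdeg mem n m) L \<and> v \<in> nodes n m \<and> p < deg mem n m v \<and>
        send A (linp mem n m L v) (tp v) (hist A mem n m pn L tp r v) p = Some b
        \<longrightarrow> real (length b) \<le> c * log 2 (real n + 1))"

definition output_cover :: "alg \<Rightarrow> (nat \<Rightarrow> nat \<Rightarrow> bool) \<Rightarrow> nat \<Rightarrow> nat \<Rightarrow> (node \<Rightarrow> nat \<Rightarrow> node) \<Rightarrow> nat
             \<Rightarrow> (node \<Rightarrow> tape) \<Rightarrow> nat set" where
  "output_cover A mem n m pn L tp =
     {i. i < n \<and> outp A (linp mem n m L (SNode i)) (tp (SNode i))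
                   (hist A mem n m pn L tp (rounds A (maxdeg mem n m) L) (SNode i))}"

definition coins :: "node set \<Rightarrow> (node \<Rightarrow> tape) measure" where
  "coins V = PiM V (\<lambda>_. PiM UNIV (\<lambda>_::nat. measure_pmf (bernoulli_pmf (1/2))))"

end

theory Submission
  imports Defs "HOL-Library.Nat_Bijection"
begin

text \<open>Parallel greedy with thresholds \<open>\<tau> = 2^d, ..., 2, 1\<close>, where \<open>2^d\<close> is about \<open>\<Delta>\<close>. For each threshold,
  the sets with at least about \<open>\<tau>\<close> uncovered elements join with probabilities \<open>1/2^d, ..., 1/2, 1\<close>.
  Since the probabilities only double, an element is covered by \<open>O(1)\<close> sets in expectation, and by
  more than \<open>K\<close> sets with probability exponentially small in \<open>K\<close>; one exponential supermartingale
  gives both. There are at most \<open>2 \<tau> OPT\<close> uncovered elements when threshold \<open>\<tau>\<close> begins, so every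
  threshold costs \<open>O(OPT)\<close> sets.

  Messages are saved differently for large and small \<open>\<tau>\<close>. If \<open>\<tau>\<close> exceeds \<open>sqrt \<Delta>\<close> by a logarithmic factor,
  an element contacts a random \<open>1/sqrt \<Delta>\<close> fraction of its ports, which suffices to estimate the number
  of uncovered elements of a set, and a joining set informs all its elements; this happens only
  about \<open>m / sqrt \<Delta>\<close> times. For smaller \<open>\<tau>\<close> every set has few uncovered elements left, so the uncovered
  elements can afford to contact all their sets, and the joining sets answer.\<close>

section \<open>Finitely many coin flips\<close>

text \<open>Three kinds of guarantee must hold for one process. Coverage must never fail, so it
  relies on no estimate: the last threshold is 1, its stages are not sparse, and the last stage of a
  scale has join probability 1. The approximation ratio is an expectation over stages that depend on
  each other; redrawing the coins of one stage with all others fixed takes the place of conditional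
  expectations, and one must not condition on accurate sampling throughout, since that event looks
  into the future. The message bound needs a tail, hence an exponential instead of a linear
  potential.

  With 2^b about sqrt \<Delta>, a sparse stage costs about 2^(d-b) messages per element and a dense
  one about 2^b per set, up to a logarithmic factor; b = d div 2 balances the two. The factor 8 * z
  in front of 2^b is what a Chernoff bound with error of order 2^-z asks for, and z is chosen such
  that the errors of all sets and stages add up to less than 1/n. The process is analysed on
  finitely many bits and without a network; the histories are then shown to simulate it.\<close>

definition bitvec :: "nat \<Rightarrow> (nat \<Rightarrow> bool) pmf" where
  "bitvec w = Pi_pmf {..<w} False (\<lambda>_. bernoulli_pmf (1/2))"

text \<open>Bits beyond \<open>w\<close> and indices outside \<open>I\<close> are fixed to
  \<open>False\<close>, so the support is finite: every real function is integrable and no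
  measurability condition arises on this side.\<close>

definition bitfun :: "'i set \<Rightarrow> nat \<Rightarrow> ('i \<Rightarrow> nat \<Rightarrow> bool) pmf" where
  "bitfun I w = Pi_pmf I (\<lambda>_. False) (\<lambda>_. bitvec w)"

lemma finite_set_bitvec: "finite (set_pmf (bitvec w))"
  unfolding bitvec_def by (subst set_Pi_pmf) (auto intro!: finite_PiE_dflt)

lemma finite_set_bitfun: "finite I \<Longrightarrow> finite (set_pmf (bitfun I w))"
  unfolding bitfun_def using finite_set_bitvec by (subst set_Pi_pmf) (auto intro!: finite_PiE_dflt)

lemma integrable_bitfun [intro, simp]:
  fixes F :: "('i \<Rightarrow> nat \<Rightarrow> bool) \<Rightarrow> real"
  shows "finite I \<Longrightarrow> integrable (measure_pmf (bitfun I w)) F"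
  by (intro integrable_measure_pmf_finite finite_set_bitfun)

text \<open>The coordinates in \<open>J\<close> and in \<open>I - J\<close> are independent, so
  redrawing the former keeps the law. This plays the part of conditioning on the coordinates outside
  \<open>J\<close>.\<close>

lemma bitfun_resample:
  assumes "finite I" "J \<subseteq> I"
  shows "bitfun I w =
    bind_pmf (bitfun I w) (\<lambda>x. map_pmf (\<lambda>y k. if k \<in> J then y k else x k) (bitfun J w))"
proof -
  have fin: "finite J" "finite (I - J)" using assms finite_subset by auto
  have split: "bitfun I w = map_pmf (\<lambda>(f,g) k. if k \<in> J then f k else g k)
      (pair_pmf (bitfun J w) (bitfun (I - J) w))"
    unfolding bitfun_def using assms fin
    by (subst Pi_pmf_union[symmetric]) (auto simp: Un_absorb1)
  have "bind_pmf (bitfun I w) (\<lambda>x. map_pmf (\<lambda>y k. if k \<in> J then y k else x k) (bitfun J w)) =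
     bind_pmf (pair_pmf (bitfun J w) (bitfun (I - J) w))
       (\<lambda>(f,g). map_pmf (\<lambda>y k. if k \<in> J then y k else g k) (bitfun J w))"
    unfolding split bind_map_pmf
    by (rule bind_pmf_cong) (auto intro!: map_pmf_cong)
  also have "\<dots> = bind_pmf (bitfun (I - J) w) (\<lambda>g. map_pmf (\<lambda>y k. if k \<in> J then y k else g k) (bitfun J w))"
    by (simp add: pair_pmf_def bind_assoc_pmf bind_return_pmf)
  also have "\<dots> = bitfun I w"
    unfolding split pair_pmf_def map_pmf_def
    by (subst bind_commute_pmf) (simp add: bind_assoc_pmf bind_return_pmf)
  finally show ?thesis by simp
qed

lemma expectation_bitfun_resample:
  fixes F :: "('i \<Rightarrow> nat \<Rightarrow> bool) \<Rightarrow> real"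
  assumes "finite I" "J \<subseteq> I"
  shows "measure_pmf.expectation (bitfun I w) F = measure_pmf.expectation (bitfun I w)
     (\<lambda>x. measure_pmf.expectation (bitfun J w) (\<lambda>y. F (\<lambda>k. if k \<in> J then y k else x k)))"
proof -
  have finJ: "finite J" using assms finite_subset by auto
  have "measure_pmf.expectation (bitfun I w) F =
    (\<Sum>x\<in>set_pmf (bitfun I w). pmf (bitfun I w) x *
       measure_pmf.expectation (bitfun J w) (\<lambda>y. F (\<lambda>k. if k \<in> J then y k else x k)))"
    by (subst bitfun_resample[OF assms],
        subst pmf_expectation_bind[of "set_pmf (bitfun I w)"])
       (auto simp: finite_set_bitfun assms finJ)
  also have "\<dots> = measure_pmf.expectation (bitfun I w)
     (\<lambda>x. measure_pmf.expectation (bitfun J w) (\<lambda>y. F (\<lambda>k. if k \<in> J then y k else x k)))"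
    by (subst integral_measure_pmf[of "set_pmf (bitfun I w)"])
       (auto simp: finite_set_bitfun assms)
  finally show ?thesis .
qed

lemma expectation_bitfun_mono_resample:
  fixes F G :: "('i \<Rightarrow> nat \<Rightarrow> bool) \<Rightarrow> real"
  assumes "finite I" "J \<subseteq> I"
    and "\<And>x. measure_pmf.expectation (bitfun J w) (\<lambda>y. F (\<lambda>k. if k \<in> J then y k else x k)) \<le> G x"
  shows "measure_pmf.expectation (bitfun I w) F \<le> measure_pmf.expectation (bitfun I w) G"
  by (subst expectation_bitfun_resample[OF assms(1,2)])
     (intro integral_mono integrable_bitfun assms)

text \<open>The pattern \<open>\<beta>\<close> is arbitrary because coins serve two purposes: all
  ones let a set join, and the low-order bits of a port let an element contact the set behind
  it.\<close>

lemma prob_bitvec_prefix: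
  assumes "k \<le> w"
  shows "measure_pmf.prob (bitvec w) {x. \<forall>i<k. x i = \<beta> i} = (1/2)^k"
proof -
  have eq: "{x. \<forall>i<k. x i = \<beta> i} = Pi {..<w} (\<lambda>i. if i < k then {\<beta> i} else UNIV)"
    using assms by (auto simp: Pi_iff split: if_splits dest: bspec)
  have "measure_pmf.prob (bitvec w) {x. \<forall>i<k. x i = \<beta> i} =
     (\<Prod>i<w. if i < k then 1/2 else 1)"
    unfolding bitvec_def eq
    by (subst measure_Pi_pmf_Pi) (auto intro!: prod.cong simp: measure_pmf_single pmf_bernoulli_half)
  also have "\<dots> = (\<Prod>i\<in>{..<k}. 1/2)"
    using assms by (intro prod.mono_neutral_cong_right) auto
  finally show ?thesis by simp
qed

text \<open>A binomial generating function. The base \<open>a\<close> will be 0 for the survival of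
  an element, 3/2 for the potential, and 1/2 and 2 for the two tails of the sampled degree.\<close>

lemma expectation_pow_card:
  fixes a :: real
  assumes "finite J" "V \<subseteq> J" "a \<ge> 0"
    and p: "\<And>v. v \<in> V \<Longrightarrow> measure_pmf.prob (bitvec w) {x. A v x} = p"
  shows "measure_pmf.expectation (bitfun J w) (\<lambda>y. a ^ card {v\<in>V. A v (y v)}) =
     (1 + (a - 1) * p) ^ card V"
proof -
  have finV: "finite V" using assms finite_subset by auto
  have pow: "a ^ card {v\<in>V. A v (y v)} = (\<Prod>v\<in>J. if v \<in> V \<and> A v (y v) then a else 1)" for y
  proof -
    have "(\<Prod>v\<in>J. if v \<in> V \<and> A v (y v) then a else 1) = (\<Prod>v\<in>{v\<in>V. A v (y v)}. a)"
      using assms by (intro prod.mono_neutral_cong_right) auto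
    then show ?thesis by simp
  qed
  have one: "measure_pmf.expectation (bitvec w) (\<lambda>x. if v \<in> V \<and> A v x then a else 1) =
      (if v \<in> V then 1 + (a - 1) * p else 1)" for v
  proof (cases "v \<in> V")
    case True
    have "measure_pmf.expectation (bitvec w) (\<lambda>x. if v \<in> V \<and> A v x then a else 1) =
      measure_pmf.expectation (bitvec w) (\<lambda>x. 1 + (a - 1) * indicator {x. A v x} x)"
      using True by (intro Bochner_Integration.integral_cong) (auto simp: indicator_def)
    also have "\<dots> = 1 + (a - 1) * p"
      using p[OF True]
      by (subst Bochner_Integration.integral_add)
         (auto intro!: integrable_measure_pmf_finite finite_set_bitvec)
    finally show ?thesis using True by simp
  qed simp
  have "measure_pmf.expectation (bitfun J w) (\<lambda>y. a ^ card {v\<in>V. A v (y v)}) =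
     (\<Prod>v\<in>J. measure_pmf.expectation (bitvec w) (\<lambda>x. if v \<in> V \<and> A v x then a else 1))"
    unfolding pow bitfun_def using assms
    by (intro expectation_prod_Pi_pmf[where f="\<lambda>v x. if v \<in> V \<and> A v x then a else 1"])
       (auto intro!: integrable_measure_pmf_finite finite_set_bitvec)
  also have "\<dots> = (\<Prod>v\<in>V. 1 + (a - 1) * p)"
    unfolding one using assms by (intro prod.mono_neutral_cong_right) auto
  finally show ?thesis by simp
qed

section \<open>Random tapes read as bit vectors\<close>

text \<open>\<open>prod_encode\<close> splits one tape into a separate block of bits for each stage.
  The mask puts the value into the range of \<open>bitfun\<close>.\<close>

definition tape_bits :: "nat \<Rightarrow> nat \<Rightarrow> 'v set \<Rightarrow> ('v \<Rightarrow> tape) \<Rightarrow> nat \<times> 'v \<Rightarrow> nat \<Rightarrow> bool" where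
  "tape_bits T w V tp =
     (\<lambda>k i. fst k < T \<and> snd k \<in> V \<and> i < w \<and> tp (snd k) (prod_encode (fst k, i)))"

lemma emeasure_cylinder:
  assumes "finite J"
  shows "emeasure (PiM UNIV (\<lambda>_::nat. measure_pmf (bernoulli_pmf (1/2)))) {x. \<forall>k\<in>J. x k = g k}
    = (1/2) ^ card J"
    and "{x. \<forall>k\<in>J. x k = g k} \<in> sets (PiM UNIV (\<lambda>_::nat. measure_pmf (bernoulli_pmf (1/2))))"
proof -
  interpret product_prob_space "\<lambda>_::nat. measure_pmf (bernoulli_pmf (1/2))" UNIV
    by unfold_locales
  have eq: "{x. \<forall>k\<in>J. x k = g k} = {x\<in>space (PiM UNIV (\<lambda>_. measure_pmf (bernoulli_pmf (1/2)))). \<forall>k\<in>J. x k \<in> {g k}}"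
    by (auto simp: space_PiM)
  show "emeasure (PiM UNIV (\<lambda>_::nat. measure_pmf (bernoulli_pmf (1/2)))) {x. \<forall>k\<in>J. x k = g k}
    = (1/2) ^ card J"
    unfolding eq using assms
    by (subst emeasure_PiM_Collect)
       (auto simp: emeasure_pmf_single pmf_bernoulli_half divide_ennreal[symmetric] divide_ennreal_def)
  show "{x. \<forall>k\<in>J. x k = g k} \<in> sets (PiM UNIV (\<lambda>_::nat. measure_pmf (bernoulli_pmf (1/2))))"
    unfolding eq using assms by (intro sets.sets_Collect_finite_All sets_Collect_single) auto
qed

text \<open>Fixing the bit vector fixes finitely many tape positions, so the preimage of a point is
  a product of cylinders.\<close>

lemma tape_bits_eq_iff:
  assumes g: "\<And>k i. g k i \<Longrightarrow> fst k < T \<and> snd k \<in> V \<and> i < w"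
  shows "tape_bits T w V tp = g \<longleftrightarrow>
    (\<forall>v\<in>V. \<forall>k\<in>prod_encode ` ({..<T} \<times> {..<w}). tp v k = (case prod_decode k of (t, i) \<Rightarrow> g (t, v) i))"
proof
  assume "tape_bits T w V tp = g"
  then show "\<forall>v\<in>V. \<forall>k\<in>prod_encode ` ({..<T} \<times> {..<w}). tp v k = (case prod_decode k of (t, i) \<Rightarrow> g (t, v) i)"
    by (auto simp: tape_bits_def)
next
  assume *: "\<forall>v\<in>V. \<forall>k\<in>prod_encode ` ({..<T} \<times> {..<w}). tp v k = (case prod_decode k of (t, i) \<Rightarrow> g (t, v) i)"
  show "tape_bits T w V tp = g"
  proof (intro ext)
    fix k i
    show "tape_bits T w V tp k i = g k i"
    proof (cases "fst k < T \<and> snd k \<in> V \<and> i < w")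
      case True
      then show ?thesis using *[rule_format, of "snd k" "prod_encode (fst k, i)"]
        by (auto simp: tape_bits_def)
    next
      case False
      then show ?thesis using g[of k i] by (auto simp: tape_bits_def)
    qed
  qed
qed

lemma pmf_bitfun:
  assumes "finite I" and g: "\<And>k i. g k i \<Longrightarrow> k \<in> I \<and> i < w"
  shows "pmf (bitfun I w) g = (1/2) ^ (w * card I)"
proof -
  have "pmf (bitvec w) (g k) = (1/2) ^ w" if "k \<in> I" for k
  proof -
    have "\<And>i. i \<notin> {..<w} \<Longrightarrow> g k i = False" using g by auto
    then show ?thesis unfolding bitvec_def
      by (subst pmf_Pi') (auto simp: pmf_bernoulli_half)
  qed
  moreover have "\<And>k. k \<notin> I \<Longrightarrow> g k = (\<lambda>_. False)" using g by blast
  ultimately show ?thesis using assms unfolding bitfun_def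
    by (subst pmf_Pi') (auto simp: power_mult)
qed

text \<open>Both laws live on the finite set \<open>\<Omega>\<close> and are uniform there, so
  comparing the masses of points suffices. Statements on infinite tapes are reduced to
  \<open>bitfun\<close> through this lemma.\<close>

lemma distr_tape_bits:
  fixes V :: "node set"
  assumes V: "finite V"
  shows "tape_bits T w V \<in> measurable (coins V) (count_space UNIV)"
    and "distr (coins V) (count_space UNIV) (tape_bits T w V) = measure_pmf (bitfun ({..<T} \<times> V) w)"
proof -
  let ?C = "PiM UNIV (\<lambda>_::nat. measure_pmf (bernoulli_pmf (1/2)))"
  let ?I = "{..<T} \<times> V"
  let ?P = "bitfun ?I w"
  let ?r = "tape_bits T w V"
  define \<Omega> where "\<Omega> = {g::nat \<times> node \<Rightarrow> nat \<Rightarrow> bool. \<forall>k i. g k i \<longrightarrow> k \<in> ?I \<and> i < w}"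
  have fin: "finite ?I" using V by auto
  have r_in: "?r tp \<in> \<Omega>" for tp by (auto simp: \<Omega>_def tape_bits_def)
  have fin\<Omega>: "finite \<Omega>"
  proof -
    have "\<Omega> \<subseteq> (\<lambda>S k i. (k, i) \<in> S) ` Pow (?I \<times> {..<w})"
    proof
      fix g assume "g \<in> \<Omega>"
      then have "g = (\<lambda>S k i. (k, i) \<in> S) {(k, i). g k i}" "{(k, i). g k i} \<in> Pow (?I \<times> {..<w})"
        by (auto simp: \<Omega>_def)
      then show "g \<in> (\<lambda>S k i. (k, i) \<in> S) ` Pow (?I \<times> {..<w})" by (rule image_eqI)
    qed
    moreover have "finite ((\<lambda>S k i. (k, i) \<in> S) ` Pow (?I \<times> {..<w}))"
      using fin by (intro finite_imageI) simp
    ultimately show ?thesis by (rule finite_subset)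
  qed
  interpret C: prob_space ?C by (intro prob_space_PiM measure_pmf.prob_space_axioms)
  interpret product_prob_space "\<lambda>_::node. ?C" V by unfold_locales
  have point: "?r -` {g} \<inter> space (coins V) \<in> sets (coins V) \<and>
      emeasure (coins V) (?r -` {g} \<inter> space (coins V)) = pmf ?P g" if "g \<in> \<Omega>" for g
  proof -
    let ?J = "prod_encode ` ({..<T} \<times> {..<w})"
    define E where "E v = {x. \<forall>k\<in>?J. x k = (case prod_decode k of (t, i) \<Rightarrow> g (t, v) i)}" for v
    have g: "fst k < T \<and> snd k \<in> V \<and> i < w" if "g k i" for k i
      using \<open>g \<in> \<Omega>\<close> that by (cases k) (auto simp: \<Omega>_def)
    have eq: "?r -` {g} \<inter> space (coins V) = PiE V E"
    proof (rule set_eqI)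
      fix tp
      have "?r tp = g \<longleftrightarrow> (\<forall>v\<in>V. tp v \<in> E v)"
        unfolding E_def mem_Collect_eq by (rule tape_bits_eq_iff) (rule g)
      then show "tp \<in> ?r -` {g} \<inter> space (coins V) \<longleftrightarrow> tp \<in> PiE V E"
        by (simp add: coins_def space_PiM PiE_iff)
    qed
    have E: "E v \<in> sets ?C" "emeasure ?C (E v) = (1/2) ^ (T * w)" for v
      unfolding E_def
      by (rule emeasure_cylinder, simp,
          subst emeasure_cylinder, simp, simp add: card_image inj_prod_encode card_cartesian_product)
    have "emeasure (coins V) (PiE V E) = (\<Prod>v\<in>V. (1/2) ^ (T * w))"
      unfolding coins_def using E V by (subst emeasure_PiM) auto
    also have "\<dots> = ennreal ((1/2) ^ (w * card ?I))"
      by (simp add: card_cartesian_product power_mult[symmetric] ac_simps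
            ennreal_power[symmetric] divide_ennreal[symmetric] divide_ennreal_def)
    also have "\<dots> = pmf ?P g"
      using g fin by (subst pmf_bitfun) (auto simp: mem_Times_iff)
    finally show ?thesis unfolding eq using E(1) V unfolding coins_def
      by (auto intro!: sets_PiM_I_finite)
  qed
  have "?r \<in> measurable (coins V) (count_space \<Omega>)"
    using point r_in fin\<Omega> by (subst measurable_count_space_eq2) auto
  then show meas: "?r \<in> measurable (coins V) (count_space UNIV)"
    by (rule measurable_compose) simp
  show "distr (coins V) (count_space UNIV) ?r = measure_pmf ?P"
  proof (rule measure_eqI)
    fix X assume "X \<in> sets (distr (coins V) (count_space UNIV) ?r)"
    have setP: "set_pmf ?P \<subseteq> \<Omega>"
    proof
      fix g assume "g \<in> set_pmf ?P"
      then have g: "\<And>k. k \<in> ?I \<Longrightarrow> g k \<in> set_pmf (bitvec w)" "\<And>k. k \<notin> ?I \<Longrightarrow> g k = (\<lambda>_. False)"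
        unfolding bitfun_def using fin by (auto simp: set_Pi_pmf PiE_dflt_def)
      have bv: "\<not> x i" if "x \<in> set_pmf (bitvec w)" "\<not> i < w" for x i
        using that set_Pi_pmf_subset[of "{..<w}" False "\<lambda>_. bernoulli_pmf (1/2)"]
        unfolding bitvec_def by blast
      have "k \<in> ?I \<and> i < w" if "g k i" for k i
        using g(2)[of k] bv[OF g(1), of k i] that by (cases "k \<in> ?I") auto
      then show "g \<in> \<Omega>" unfolding \<Omega>_def by blast
    qed
    have "emeasure (distr (coins V) (count_space UNIV) ?r) X =
        emeasure (distr (coins V) (count_space UNIV) ?r) (X \<inter> \<Omega>)"
      using meas r_in by (subst (1 2) emeasure_distr) (auto intro!: arg_cong[where f="emeasure _"])
    also have "\<dots> = (\<Sum>g\<in>X \<inter> \<Omega>. emeasure (distr (coins V) (count_space UNIV) ?r) {g})"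
      using fin\<Omega> by (intro emeasure_eq_sum_singleton) auto
    also have "\<dots> = (\<Sum>g\<in>X \<inter> \<Omega>. emeasure (measure_pmf ?P) {g})"
      using point meas by (intro sum.cong) (auto simp: emeasure_distr emeasure_pmf_single)
    also have "\<dots> = emeasure (measure_pmf ?P) (X \<inter> \<Omega>)"
      using fin\<Omega> by (intro emeasure_eq_sum_singleton[symmetric]) auto
    also have "\<dots> = emeasure (measure_pmf ?P) X"
    proof -
      have "X \<inter> \<Omega> \<inter> set_pmf ?P = X \<inter> set_pmf ?P" using setP by blast
      then show ?thesis by (metis emeasure_Int_set_pmf)
    qed
    finally show "emeasure (distr (coins V) (count_space UNIV) ?r) X = emeasure (measure_pmf ?P) X" .
  qed simp
qed

lemma measurable_tape_bits:
  fixes V :: "node set" and F :: "_ \<Rightarrow> real"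
  assumes "finite V"
  shows "(\<lambda>tp. F (tape_bits T w V tp)) \<in> borel_measurable (coins V)"
  using distr_tape_bits(1)[OF assms] by (rule measurable_compose) simp

lemma integral_tape_bits:
  fixes V :: "node set" and F :: "_ \<Rightarrow> real"
  assumes "finite V"
  shows "(\<integral>tp. F (tape_bits T w V tp) \<partial>coins V) = measure_pmf.expectation (bitfun ({..<T} \<times> V) w) F"
  unfolding distr_tape_bits(2)[OF assms, symmetric]
  by (rule integral_distr[symmetric]) (auto simp: distr_tape_bits(1)[OF assms])

lemma measure_tape_bits:
  fixes V :: "node set"
  assumes "finite V"
  shows "measure (coins V) {tp\<in>space (coins V). Q (tape_bits T w V tp)} =
    measure_pmf.prob (bitfun ({..<T} \<times> V) w) {g. Q g}"
proof -
  have "measure_pmf.prob (bitfun ({..<T} \<times> V) w) {g. Q g} =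
      measure (coins V) (tape_bits T w V -` {g. Q g} \<inter> space (coins V))"
    unfolding distr_tape_bits(2)[OF assms, symmetric]
    by (rule measure_distr) (auto simp: distr_tape_bits(1)[OF assms])
  then show ?thesis by (simp add: vimage_def Int_def conj_commute)
qed

section \<open>The schedule and the random process\<close>

text \<open>Stage \<open>t\<close> has index \<open>j = t mod (d + 1)\<close> in scale \<open>t div (d + 1)\<close>: sets whose number of uncovered
  elements seems to be at least \<open>tau d t\<close> join with probability \<open>2 ^ j / 2 ^ d\<close>. In a sparse stage an
  element contacts only the sets behind the ports with \<open>b\<close> prescribed low-order bits, that is, each set
  with probability \<open>1 / 2 ^ b\<close>, while its number of messages is bounded with certainty.\<close>

definition tau :: "nat \<Rightarrow> nat \<Rightarrow> nat" where
  "tau d t = 2 ^ (d - t div (d + 1))"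

definition sparse :: "nat \<Rightarrow> nat \<Rightarrow> nat \<Rightarrow> nat \<Rightarrow> bool" where
  "sparse d b \<kappa> t \<longleftrightarrow> \<kappa> * 2 ^ b \<le> tau d t"

definition sbits :: "nat \<Rightarrow> nat \<Rightarrow> nat \<Rightarrow> nat \<Rightarrow> nat" where
  "sbits d b \<kappa> t = (if sparse d b \<kappa> t then b else 0)"

definition stages :: "nat \<Rightarrow> nat" where
  "stages d = (d + 1) * (d + 1)"

type_synonym flips = "nat \<times> node \<Rightarrow> nat \<Rightarrow> bool"

text \<open>\<open>port\<close> is unconstrained here: the coins of an element match any prescribed
  bits with probability 2^-b, whatever the port numbers are. \<open>b \<le> d\<close> ensures that
  \<open>d\<close> coins per slot are enough.\<close>

locale sampled_cover =
  fixes n m :: nat and mem :: "nat \<Rightarrow> nat \<Rightarrow> bool" and port :: "nat \<Rightarrow> nat \<Rightarrow> nat"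
    and d b \<kappa> z :: nat
  assumes elem_deg: "e < m \<Longrightarrow> card {S. S < n \<and> mem S e} \<le> 2 ^ d"
    and set_deg: "S < n \<Longrightarrow> card {e. e < m \<and> mem S e} \<le> 2 ^ d"
    and kappa: "8 * z \<le> \<kappa>" and z_pos: "0 < z" and b_le: "b \<le> d"
    and coverable: "e < m \<Longrightarrow> \<exists>S<n. mem S e"
begin

definition heard :: "flips \<Rightarrow> nat \<Rightarrow> nat set \<Rightarrow> nat \<Rightarrow> nat set" where
  "heard \<omega> t al S = {e. e < m \<and> e \<in> al \<and> mem S e \<and>
     (\<forall>i<sbits d b \<kappa> t. \<omega> (t, ENode e) i = odd (port e S div 2 ^ i))}"

text \<open>The estimate is compared with half of \<open>tau\<close>: in expectation, a set with
  \<open>tau\<close> uncovered elements passes the bar by a factor 2, and one with less than a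
  quarter of \<open>tau\<close> misses it by a factor 2.\<close>

definition looks_heavy :: "flips \<Rightarrow> nat \<Rightarrow> nat set \<Rightarrow> nat \<Rightarrow> bool" where
  "looks_heavy \<omega> t al S \<longleftrightarrow> tau d t \<le> 2 * 2 ^ sbits d b \<kappa> t * card (heard \<omega> t al S)"

definition heavy_of :: "flips \<Rightarrow> nat \<Rightarrow> nat set \<times> nat set \<Rightarrow> nat set" where
  "heavy_of \<omega> t s = {S\<in>snd s. looks_heavy \<omega> t (fst s) S}"

definition join_of :: "flips \<Rightarrow> nat \<Rightarrow> nat set \<times> nat set \<Rightarrow> nat set" where
  "join_of \<omega> t s = {S\<in>heavy_of \<omega> t s. \<forall>i<d - t mod (d + 1). \<omega> (t, SNode S) i}"

text \<open>The state before stage \<open>t\<close>: the uncovered elements, and the sets that looked heavy in all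
  earlier stages of the current scale. The second component makes the number of candidates at an
  element nonincreasing within a scale, although every stage samples anew.\<close>

primrec state :: "flips \<Rightarrow> nat \<Rightarrow> nat set \<times> nat set" where
  "state \<omega> 0 = ({..<m}, {..<n})"
| "state \<omega> (Suc t) = ({e\<in>fst (state \<omega> t). \<forall>S\<in>join_of \<omega> t (state \<omega> t). \<not> mem S e},
     if Suc t mod (d + 1) = 0 then {..<n} else heavy_of \<omega> t (state \<omega> t))"

definition "alive \<omega> t = fst (state \<omega> t)"
definition "cand \<omega> t = snd (state \<omega> t)"
definition "heavy \<omega> t = heavy_of \<omega> t (state \<omega> t)"
definition "joins \<omega> t = join_of \<omega> t (state \<omega> t)"

lemma alive_0 [simp]: "alive \<omega> 0 = {..<m}"
  and alive_Suc: "alive \<omega> (Suc t) = {e\<in>alive \<omega> t. \<forall>S\<in>joins \<omega> t. \<not> mem S e}"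
  and cand_0 [simp]: "cand \<omega> 0 = {..<n}"
  and cand_Suc: "cand \<omega> (Suc t) = (if Suc t mod (d + 1) = 0 then {..<n} else heavy \<omega> t)"
  and heavy_eq: "heavy \<omega> t = {S\<in>cand \<omega> t. looks_heavy \<omega> t (alive \<omega> t) S}"
  and joins_eq: "joins \<omega> t = {S\<in>heavy \<omega> t. \<forall>i<d - t mod (d + 1). \<omega> (t, SNode S) i}"
  by (simp_all add: alive_def cand_def heavy_def joins_def) (auto simp: heavy_of_def join_of_def)

lemma alive_subset: "alive \<omega> t \<subseteq> {..<m}"
  by (induction t) (auto simp: alive_Suc)

lemma cand_subset: "cand \<omega> t \<subseteq> {..<n}"
  by (induction t) (auto simp: cand_Suc heavy_eq)

lemma heavy_subset_cand: "heavy \<omega> t \<subseteq> cand \<omega> t"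
  by (auto simp: heavy_eq)

lemma joins_subset_heavy: "joins \<omega> t \<subseteq> heavy \<omega> t"
  by (auto simp: joins_eq)

lemma finite_alive [simp]: "finite (alive \<omega> t)"
  using alive_subset finite_subset by blast

lemma finite_cand [simp]: "finite (cand \<omega> t)"
  using cand_subset finite_subset by blast

lemma finite_heavy [simp]: "finite (heavy \<omega> t)"
  using heavy_subset_cand finite_cand finite_subset by blast

lemma finite_joins [simp]: "finite (joins \<omega> t)"
  using joins_subset_heavy finite_heavy finite_subset by blast

lemma joins_subset: "joins \<omega> t \<subseteq> {..<n}"
  using joins_subset_heavy heavy_subset_cand cand_subset by blast

lemma alive_antimono: "t \<le> t' \<Longrightarrow> alive \<omega> t' \<subseteq> alive \<omega> t"
  by (induction t' rule: nat_induct_at_least) (auto simp: alive_Suc)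

lemma mem_cand_iff:
  "S \<in> cand \<omega> t \<longleftrightarrow> S < n \<and> (\<forall>t'. t - t mod (d + 1) \<le> t' \<and> t' < t \<longrightarrow> looks_heavy \<omega> t' (alive \<omega> t') S)"
proof (induction t)
  case (Suc t)
  show ?case
  proof (cases "Suc t mod (d + 1) = 0")
    case True
    then show ?thesis by (auto simp: cand_Suc)
  next
    case False
    then have "Suc t - Suc t mod (d + 1) = t - t mod (d + 1)"
      by (simp add: mod_Suc split: if_splits)
    then show ?thesis using False Suc
      by (auto simp: cand_Suc heavy_eq less_Suc_eq)
  qed
qed simp

text \<open>This closed form of the recursion is what a set can evaluate from its own
  history.\<close>

lemma mem_heavy_iff:
  "S \<in> heavy \<omega> t \<longleftrightarrow> S < n \<and> (\<forall>t'\<in>{t - t mod (d + 1)..t}. looks_heavy \<omega> t' (alive \<omega> t') S)"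
proof -
  have "{t - t mod (d + 1)..t} = insert t {t'. t - t mod (d + 1) \<le> t' \<and> t' < t}" by auto
  then show ?thesis unfolding heavy_eq by (auto simp: mem_cand_iff)
qed

lemma state_cong:
  assumes "\<And>t' v. t' < t \<Longrightarrow> \<omega> (t', v) = \<omega>' (t', v)"
  shows "alive \<omega> t = alive \<omega>' t" "cand \<omega> t = cand \<omega>' t"
proof -
  have "state \<omega> t = state \<omega>' t" using assms
  proof (induction t)
    case (Suc t)
    then have IH: "state \<omega> t = state \<omega>' t" by simp
    have "heavy_of \<omega> t s = heavy_of \<omega>' t s" "join_of \<omega> t s = join_of \<omega>' t s" for s
      using Suc.prems[of t] by (auto simp: heavy_of_def join_of_def looks_heavy_def heard_def)
    then show ?case by (simp add: IH)
  qed simp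
  then show "alive \<omega> t = alive \<omega>' t" "cand \<omega> t = cand \<omega>' t"
    by (simp_all add: alive_def cand_def)
qed

text \<open>Within stage \<open>t\<close>, heaviness depends on the coins of the elements only. The
  coins of the sets are still fresh once \<open>heavy\<close> is known, and the covering argument
  averages over these alone.\<close>

lemma heavy_cong:
  assumes "\<And>t' v. t' < t \<Longrightarrow> \<omega> (t', v) = \<omega>' (t', v)" "\<And>e. \<omega> (t, ENode e) = \<omega>' (t, ENode e)"
  shows "heavy \<omega> t = heavy \<omega>' t"
proof -
  have "alive \<omega> t = alive \<omega>' t" "cand \<omega> t = cand \<omega>' t"
    using assms(1) by (intro state_cong; blast)+
  then show ?thesis using assms(2) by (simp add: heavy_eq looks_heavy_def heard_def)
qed

section \<open>The covering potential\<close>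

definition hits :: "flips \<Rightarrow> nat \<Rightarrow> nat \<Rightarrow> nat" where
  "hits \<omega> t e = card {S\<in>joins \<omega> t. mem S e}"

text \<open>An element is charged at most once, in the stage that covers it. By Bernoulli's
  inequality the exponential dominates \<open>hits\<close> up to a factor 2; it is also large enough
  for a Markov tail bound.\<close>

definition charge :: "flips \<Rightarrow> nat \<Rightarrow> nat \<Rightarrow> real" where
  "charge \<omega> t e = (if e \<in> alive \<omega> t then (3/2) ^ hits \<omega> t e - 1 else 0)"

text \<open>\<open>past_prob\<close> is the sum of the join probabilities of the earlier stages of the scale. An element
  with \<open>h\<close> candidates at this point has survived with probability at most \<open>exp (- h * past_prob t)\<close>;
  the potential trades half of that exponent against the size of the next hit.\<close>

definition past_prob :: "nat \<Rightarrow> real" where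
  "past_prob t = (2 ^ (t mod (d + 1)) - 1) / 2 ^ d"

definition join_prob :: "nat \<Rightarrow> real" where
  "join_prob t = (1/2) ^ (d - t mod (d + 1))"

definition potential :: "flips \<Rightarrow> nat \<Rightarrow> nat \<Rightarrow> real" where
  "potential \<omega> t e =
     (if e \<in> alive \<omega> t then exp (real (card {S\<in>cand \<omega> t. mem S e}) * past_prob t / 2) else 0)"

lemma past_prob_nonneg: "past_prob t \<ge> 0"
  by (simp add: past_prob_def)

lemma join_prob_bounds: "0 \<le> join_prob t" "join_prob t \<le> 1"
  by (auto simp: join_prob_def power_le_one)

text \<open>Since 1 + 2 + ... + 2^(j-1) = 2^j - 1, a join probability exceeds the sum of the earlier
  ones in its scale by just 1/2^d. For an element in at most 2^d sets this excess amounts to at most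
  one expected hit.\<close>

lemma join_prob_eq: "join_prob t = past_prob t + 1 / 2 ^ d"
proof -
  have "t mod (d + 1) \<le> d" by (simp add: less_Suc_eq_le[symmetric])
  then show ?thesis
    by (simp add: join_prob_def past_prob_def power_diff field_simps power_one_over)
qed

lemma past_prob_Suc:
  "past_prob (Suc t) = (if Suc t mod (d + 1) = 0 then 0 else past_prob t + join_prob t)"
proof (cases "Suc t mod (d + 1) = 0")
  case False
  then have "Suc t mod (d + 1) = Suc (t mod (d + 1))" by (simp add: mod_Suc split: if_splits)
  then show ?thesis using False
    by (simp add: join_prob_eq) (simp add: past_prob_def field_simps)
qed (simp add: past_prob_def)

lemma charge_nonneg: "charge \<omega> t e \<ge> 0"
  by (simp add: charge_def)

lemma potential_nonneg: "potential \<omega> t e \<ge> 0"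
  by (simp add: potential_def)

lemma hits_le_charge:
  assumes "e \<in> alive \<omega> t"
  shows "real (hits \<omega> t e) \<le> 2 * charge \<omega> t e"
proof -
  have "1 + real (hits \<omega> t e) * (1/2) \<le> (1 + 1/2) ^ hits \<omega> t e"
    by (rule Bernoulli_inequality) simp
  then show ?thesis using assms by (simp add: charge_def)
qed

abbreviation set_slots :: "nat \<Rightarrow> (nat \<times> node) set" where
  "set_slots t \<equiv> Pair t ` SNode ` {..<n}"

abbreviation elem_slots :: "nat \<Rightarrow> (nat \<times> node) set" where
  "elem_slots t \<equiv> Pair t ` ENode ` {..<m}"

abbreviation flip_space :: "flips pmf" where
  "flip_space \<equiv> bitfun ({..<stages d} \<times> nodes n m) d"

lemma finite_slots: "finite ({..<stages d} \<times> nodes n m)"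
  by (auto simp: nodes_def)

lemma slots_subset:
  "t < stages d \<Longrightarrow> set_slots t \<subseteq> {..<stages d} \<times> nodes n m"
  "t < stages d \<Longrightarrow> elem_slots t \<subseteq> {..<stages d} \<times> nodes n m"
  by (auto simp: nodes_def)

text \<open>With the coins of the elements fixed, the number of hits is binomial: one independent
  trial for each heavy set that contains \<open>e\<close>.\<close>

lemma expectation_pow_hits:
  assumes "a \<ge> 0"
  shows "measure_pmf.expectation (bitfun (set_slots t) d)
      (\<lambda>y. a ^ hits (\<lambda>k. if k \<in> set_slots t then y k else \<omega> k) t e) =
    (1 + (a - 1) * join_prob t) ^ card {S\<in>heavy \<omega> t. mem S e}"
proof -
  let ?V = "(\<lambda>S. (t, SNode S)) ` {S\<in>heavy \<omega> t. mem S e}"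
  have inj: "inj_on (\<lambda>S. (t, SNode S)) A" for A by (auto simp: inj_on_def)
  have "hits (\<lambda>k. if k \<in> set_slots t then y k else \<omega> k) t e
      = card {v\<in>?V. \<forall>i<d - t mod (d + 1). y v i}" for y
  proof -
    let ?o = "\<lambda>k. if k \<in> set_slots t then y k else \<omega> k"
    have "heavy ?o t = heavy \<omega> t" by (rule heavy_cong) auto
    moreover have "S < n" if "S \<in> heavy \<omega> t" for S using that mem_heavy_iff by blast
    ultimately have "{v\<in>?V. \<forall>i<d - t mod (d + 1). y v i} = (\<lambda>S. (t, SNode S)) ` {S\<in>joins ?o t. mem S e}"
      by (auto simp: joins_eq)
    then show ?thesis unfolding hits_def by (simp add: card_image[OF inj])
  qed
  moreover have "?V \<subseteq> set_slots t" using mem_heavy_iff by auto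
  ultimately show ?thesis
    using assms expectation_pow_card[where J="set_slots t" and V="?V" and a=a and w=d
        and A="\<lambda>_ x. \<forall>i<d - t mod (d + 1). x i" and p="join_prob t"]
      prob_bitvec_prefix[of "d - t mod (d + 1)" d "\<lambda>_. True"]
    by (simp add: join_prob_def card_image[OF inj])
qed

lemma alive_Suc_iff: "e \<in> alive \<omega> (Suc t) \<longleftrightarrow> e \<in> alive \<omega> t \<and> hits \<omega> t e = 0"
  by (auto simp: alive_Suc hits_def)

text \<open>The power of 0 is the indicator of survival, in the form to which the generating
  function at 0 applies. When a scale ends, the potential of a survivor resets to 1, which the
  exponential majorizes.\<close>

lemma potential_Suc_le:
  assumes "e \<in> alive \<omega> t"
  shows "potential \<omega> (Suc t) e \<le> 0 ^ hits \<omega> t e *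
    exp (real (card {S\<in>heavy \<omega> t. mem S e}) * (past_prob t + join_prob t) / 2)"
  using assms past_prob_nonneg[of t] join_prob_bounds[of t]
  by (simp add: potential_def alive_Suc_iff past_prob_Suc cand_Suc)

text \<open>Put x = exp (- h p / 2). By (1 - p)^h \<le> exp (- h p) the survivors keep at most exp
  (h q / 2) x. By (1 + p/2)^h \<le> exp (h p / 2) the hits cost at most exp (h p / 2 - 1/2) (1 - x),
  where the last hypothesis bounds h p by h q + 1 and the weight exp (-1/2) cancels that 1. The two
  parts sum to the right side.\<close>

lemma potential_step_real:
  fixes p q :: real
  assumes "0 \<le> p" "p \<le> 1" "real h * p \<le> real h * q + 1"
  shows "exp (-1/2) * ((1 + p/2) ^ h - 1) + (1 - p) ^ h * exp (real h * (q + p) / 2)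
    \<le> exp (real h * q / 2)"
proof -
  have a: "(1 + p/2) ^ h \<le> exp (h * p / 2)"
  proof -
    have "(1 + p/2) ^ h \<le> exp (p/2) ^ h" using assms by (intro power_mono exp_ge_add_one_self) auto
    then show ?thesis by (simp add: exp_of_nat_mult[symmetric])
  qed
  have c: "(1 - p) ^ h \<le> exp (- (h * p))"
  proof -
    have "(1 - p) ^ h \<le> exp (- p) ^ h"
      using assms exp_ge_add_one_self[of "-p"] by (intro power_mono) auto
    then show ?thesis by (simp add: exp_of_nat_mult[symmetric])
  qed
  have "exp (-1/2) * ((1 + p/2) ^ h - 1) \<le> exp (-1/2) * (exp (h * p / 2) - 1)"
    using a by (intro mult_left_mono) auto
  also have "\<dots> = exp (h * p / 2 - 1 / 2) * (1 - exp (- (h * p / 2)))"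
    by (simp add: algebra_simps exp_add[symmetric])
  also have "\<dots> \<le> exp (h * q / 2) * (1 - exp (- (h * p / 2)))"
    using assms by (intro mult_right_mono) auto
  finally have 1: "exp (-1/2) * ((1 + p/2) ^ h - 1) \<le> exp (h * q / 2) * (1 - exp (- (h * p / 2)))" .
  have "(1 - p) ^ h * exp (h * (q + p) / 2) \<le> exp (- (h * p)) * exp (h * (q + p) / 2)"
    using c by (intro mult_right_mono) auto
  also have "\<dots> = exp (h * q / 2) * exp (- (h * p / 2))"
    by (simp add: exp_add[symmetric] field_simps)
  finally show ?thesis using 1 by (simp add: algebra_simps)
qed

lemma potential_step:
  "measure_pmf.expectation (bitfun (set_slots t) d)
     (\<lambda>y. let \<omega>' = (\<lambda>k. if k \<in> set_slots t then y k else \<omega> k)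
          in exp (-1/2) * charge \<omega>' t e + potential \<omega>' (Suc t) e) \<le> potential \<omega> t e"
proof -
  define o' where "o' y = (\<lambda>k. if k \<in> set_slots t then y k else \<omega> k)" for y
  have al: "alive (o' y) t = alive \<omega> t" for y by (rule state_cong) (auto simp: o'_def)
  have hvy: "heavy (o' y) t = heavy \<omega> t" for y by (rule heavy_cong) (auto simp: o'_def)
  show ?thesis
  proof (cases "e \<in> alive \<omega> t")
    case False
    then show ?thesis
      by (simp add: o'_def[symmetric] charge_def potential_def alive_Suc_iff al)
  next
    case True
    define h where "h = card {S\<in>heavy \<omega> t. mem S e}"
    let ?p = "join_prob t" and ?q = "past_prob t"
    let ?M = "bitfun (set_slots t) d"
    have int: "integrable (measure_pmf ?M) f" for f :: "flips \<Rightarrow> real"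
      by (intro integrable_bitfun) simp
    have e32: "measure_pmf.expectation ?M (\<lambda>y. (3/2) ^ hits (o' y) t e) = (1 + ?p/2) ^ h"
      using expectation_pow_hits[of "3/2" t \<omega> e] by (simp add: o'_def h_def)
    have e0: "measure_pmf.expectation ?M (\<lambda>y. 0 ^ hits (o' y) t e) = (1 - ?p) ^ h"
      using expectation_pow_hits[of 0 t \<omega> e] by (simp add: o'_def h_def)
    have "e < m" using True alive_subset by blast
    have "h \<le> 2 ^ d"
    proof -
      have "h \<le> card {S. S < n \<and> mem S e}" unfolding h_def
        by (intro card_mono) (auto simp: mem_heavy_iff)
      then show ?thesis using elem_deg[OF \<open>e < m\<close>] by simp
    qed
    then have "real h \<le> 2 ^ d" by (metis of_nat_le_iff of_nat_numeral of_nat_power)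
    then have hp: "real h * ?p \<le> real h * ?q + 1"
      by (simp add: join_prob_eq field_simps)
    have "measure_pmf.expectation ?M (\<lambda>y. exp (-1/2) * charge (o' y) t e + potential (o' y) (Suc t) e)
      \<le> measure_pmf.expectation ?M (\<lambda>y. exp (-1/2) * ((3/2) ^ hits (o' y) t e - 1) +
          0 ^ hits (o' y) t e * exp (real h * (?q + ?p) / 2))"
      using True potential_Suc_le[of e "o' _" t]
      by (intro integral_mono int) (auto simp: charge_def al hvy h_def)
    also have "\<dots> = exp (-1/2) * ((1 + ?p/2) ^ h - 1) + (1 - ?p) ^ h * exp (real h * (?q + ?p) / 2)"
      using int by (simp add: e32 e0)
    also have "\<dots> \<le> exp (real h * ?q / 2)"
      using join_prob_bounds[of t] hp by (intro potential_step_real) auto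
    also have "\<dots> \<le> exp (real (card {S\<in>cand \<omega> t. mem S e}) * ?q / 2)"
    proof -
      have "h \<le> card {S\<in>cand \<omega> t. mem S e}"
        unfolding h_def using heavy_subset_cand by (intro card_mono) auto
      then show ?thesis using past_prob_nonneg[of t] by (simp add: mult_right_mono)
    qed
    finally show ?thesis using True by (simp add: o'_def[symmetric] potential_def Let_def)
  qed
qed

text \<open>The weight \<open>Z\<close> is determined before stage \<open>t0\<close>, so redrawing
  stage \<open>t\<close> leaves it unchanged and it factors out of the inner expectation.\<close>

lemma expected_charge_step:
  assumes "t0 \<le> t" "t < stages d"
    and Z: "\<And>\<omega>. Z \<omega> \<ge> 0"
      "\<And>\<omega> \<omega>'. (\<And>t v. t < t0 \<Longrightarrow> \<omega> (t, v) = \<omega>' (t, v)) \<Longrightarrow> Z \<omega> = Z \<omega>'"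
  shows "measure_pmf.expectation flip_space
       (\<lambda>\<omega>. Z \<omega> * (exp (-1/2) * charge \<omega> t e + potential \<omega> (Suc t) e))
    \<le> measure_pmf.expectation flip_space (\<lambda>\<omega>. Z \<omega> * potential \<omega> t e)"
proof (rule expectation_bitfun_mono_resample[OF finite_slots slots_subset(1)[OF assms(2)]])
  fix \<omega>
  have "Z (\<lambda>k. if k \<in> set_slots t then y k else \<omega> k) = Z \<omega>" for y
    using assms(1) by (intro Z(2)) auto
  then have "measure_pmf.expectation (bitfun (set_slots t) d)
      (\<lambda>y. Z (\<lambda>k. if k \<in> set_slots t then y k else \<omega> k) *
         (exp (-1/2) * charge (\<lambda>k. if k \<in> set_slots t then y k else \<omega> k) t e +
          potential (\<lambda>k. if k \<in> set_slots t then y k else \<omega> k) (Suc t) e))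
    = Z \<omega> * measure_pmf.expectation (bitfun (set_slots t) d)
      (\<lambda>y. exp (-1/2) * charge (\<lambda>k. if k \<in> set_slots t then y k else \<omega> k) t e +
          potential (\<lambda>k. if k \<in> set_slots t then y k else \<omega> k) (Suc t) e)"
    by simp
  also have "\<dots> \<le> Z \<omega> * potential \<omega> t e"
    using potential_step[of t \<omega> e] Z(1) by (intro mult_left_mono) (auto simp: Let_def)
  finally show "measure_pmf.expectation (bitfun (set_slots t) d)
      (\<lambda>y. Z (\<lambda>k. if k \<in> set_slots t then y k else \<omega> k) *
         (exp (-1/2) * charge (\<lambda>k. if k \<in> set_slots t then y k else \<omega> k) t e +
          potential (\<lambda>k. if k \<in> set_slots t then y k else \<omega> k) (Suc t) e))
    \<le> Z \<omega> * potential \<omega> t e" .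
qed

lemma mult_add_swap: "(x::real) * (c * y + u) = c * (x * y) + x * u"
  by (simp add: algebra_simps)

text \<open>The one-step bounds telescope, the last potential is dropped, and exp (-1/2) \<ge> 1/2
  gives the factor 2. The weight \<open>Z\<close> permits restarting at any stage with only some of
  the runs.\<close>

lemma expected_charge:
  assumes "t0 \<le> t1" "t1 \<le> stages d"
    and Z: "\<And>\<omega>. Z \<omega> \<ge> 0"
      "\<And>\<omega> \<omega>'. (\<And>t v. t < t0 \<Longrightarrow> \<omega> (t, v) = \<omega>' (t, v)) \<Longrightarrow> Z \<omega> = Z \<omega>'"
  shows "measure_pmf.expectation flip_space (\<lambda>\<omega>. Z \<omega> * (\<Sum>t=t0..<t1. charge \<omega> t e))
    \<le> 2 * measure_pmf.expectation flip_space (\<lambda>\<omega>. Z \<omega> * potential \<omega> t0 e)"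
proof -
  note int = integrable_bitfun[OF finite_slots]
  let ?E = "measure_pmf.expectation flip_space"
  have main: "exp (-1/2) * ?E (\<lambda>\<omega>. Z \<omega> * (\<Sum>t=t0..<t1. charge \<omega> t e)) + ?E (\<lambda>\<omega>. Z \<omega> * potential \<omega> t1 e)
    \<le> ?E (\<lambda>\<omega>. Z \<omega> * potential \<omega> t0 e)"
    using assms(1,2)
  proof (induction t1 rule: nat_induct_at_least)
    case (Suc t)
    let ?A = "?E (\<lambda>\<omega>. Z \<omega> * (\<Sum>t=t0..<t. charge \<omega> t e))"
      and ?B = "?E (\<lambda>\<omega>. Z \<omega> * charge \<omega> t e)"
      and ?C = "?E (\<lambda>\<omega>. Z \<omega> * potential \<omega> (Suc t) e)"
    have "(\<lambda>\<omega>. Z \<omega> * (\<Sum>t=t0..<Suc t. charge \<omega> t e)) =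
        (\<lambda>\<omega>. Z \<omega> * (\<Sum>t=t0..<t. charge \<omega> t e) + Z \<omega> * charge \<omega> t e)"
      using Suc.hyps by (simp add: distrib_left)
    then have 1: "?E (\<lambda>\<omega>. Z \<omega> * (\<Sum>t=t0..<Suc t. charge \<omega> t e)) = ?A + ?B"
      by (simp add: int)
    have "(\<lambda>\<omega>. Z \<omega> * (exp (-1/2) * charge \<omega> t e + potential \<omega> (Suc t) e)) =
        (\<lambda>\<omega>. exp (-1/2) * (Z \<omega> * charge \<omega> t e) + Z \<omega> * potential \<omega> (Suc t) e)"
      by (rule ext) (rule mult_add_swap)
    then have 2: "?E (\<lambda>\<omega>. Z \<omega> * (exp (-1/2) * charge \<omega> t e + potential \<omega> (Suc t) e))
        = exp (-1/2) * ?B + ?C"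
      by (simp add: int)
    have "exp (-1/2) * ?E (\<lambda>\<omega>. Z \<omega> * (\<Sum>t=t0..<Suc t. charge \<omega> t e)) + ?C
      = exp (-1/2) * ?A + ?E (\<lambda>\<omega>. Z \<omega> * (exp (-1/2) * charge \<omega> t e + potential \<omega> (Suc t) e))"
      unfolding 1 2 by (simp add: distrib_left)
    also have "\<dots> \<le> exp (-1/2) * ?A + ?E (\<lambda>\<omega>. Z \<omega> * potential \<omega> t e)"
    proof (intro add_left_mono expected_charge_step)
      show "t0 \<le> t" "t < stages d" using Suc.hyps Suc.prems by simp_all
    qed (fact Z)+
    finally show ?case using Suc by simp
  qed simp
  have "?E (\<lambda>\<omega>. Z \<omega> * potential \<omega> t1 e) \<ge> 0"
    using Z(1) potential_nonneg by (intro Bochner_Integration.integral_nonneg) simp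
  with main have "exp (-1/2) * ?E (\<lambda>\<omega>. Z \<omega> * (\<Sum>t=t0..<t1. charge \<omega> t e))
    \<le> ?E (\<lambda>\<omega>. Z \<omega> * potential \<omega> t0 e)" by simp
  moreover have "1/2 \<le> exp (-1/2 :: real)" using exp_ge_add_one_self[of "-1/2 :: real"] by simp
  moreover have "?E (\<lambda>\<omega>. Z \<omega> * (\<Sum>t=t0..<t1. charge \<omega> t e)) \<ge> 0"
    using Z(1) charge_nonneg by (intro Bochner_Integration.integral_nonneg) (simp add: sum_nonneg)
  ultimately have "1/2 * ?E (\<lambda>\<omega>. Z \<omega> * (\<Sum>t=t0..<t1. charge \<omega> t e)) \<le> ?E (\<lambda>\<omega>. Z \<omega> * potential \<omega> t0 e)"
    by (meson mult_right_mono order_trans)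
  then show ?thesis by simp
qed

lemma potential_scale_start: "potential \<omega> (s * (d + 1)) e = (if e \<in> alive \<omega> (s * (d + 1)) then 1 else 0)"
proof -
  have "past_prob (s * (d + 1)) = 0"
    unfolding past_prob_def by (subst mod_mult_self2_is_0) simp
  then show ?thesis by (simp add: potential_def)
qed

text \<open>Markov's inequality for the total charge, whose expectation is at most 2 per element;
  one stage with \<open>K\<close> hits already contributes (3/2)^K - 1.\<close>

lemma prob_many_hits:
  assumes "K > 0"
  shows "measure_pmf.prob flip_space {\<omega>. \<exists>t<stages d. \<exists>e\<in>alive \<omega> t. K \<le> hits \<omega> t e}
     \<le> 2 * real m / ((3/2) ^ K - 1)"
proof -
  note int = integrable_bitfun[OF finite_slots]
  let ?E = "measure_pmf.expectation flip_space"
  let ?A = "{\<omega>. \<exists>t<stages d. \<exists>e\<in>alive \<omega> t. K \<le> hits \<omega> t e}"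
  have gt: "(3/2::real) ^ K > 1" using assms by (simp add: one_less_power)
  have "measure_pmf.prob flip_space ?A = ?E (indicator ?A)" by simp
  also have "\<dots> \<le> ?E (\<lambda>\<omega>. \<Sum>e<m. (\<Sum>t=0..<stages d. charge \<omega> t e) / ((3/2) ^ K - 1))"
  proof (intro integral_mono int)
    fix \<omega>
    have nonneg: "0 \<le> (\<Sum>t=0..<stages d. charge \<omega> t e) / ((3/2) ^ K - 1)" for e
      using gt charge_nonneg by (intro divide_nonneg_pos sum_nonneg) auto
    show "indicator ?A \<omega> \<le> (\<Sum>e<m. (\<Sum>t=0..<stages d. charge \<omega> t e) / ((3/2) ^ K - 1))"
    proof (cases "\<omega> \<in> ?A")
      case True
      then obtain t e where te: "t < stages d" "e \<in> alive \<omega> t" "K \<le> hits \<omega> t e" by auto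
      have "e < m" using te(2) alive_subset by blast
      have "(3/2::real) ^ K \<le> (3/2) ^ hits \<omega> t e" using te(3) by (intro power_increasing) auto
      then have "(3/2) ^ K - 1 \<le> charge \<omega> t e" using te(2) by (simp add: charge_def)
      also have "\<dots> \<le> (\<Sum>t=0..<stages d. charge \<omega> t e)"
        using te(1) charge_nonneg by (intro member_le_sum) auto
      finally have "1 \<le> (\<Sum>t=0..<stages d. charge \<omega> t e) / ((3/2) ^ K - 1)"
        using gt by (simp add: field_simps)
      also have "\<dots> \<le> (\<Sum>e<m. (\<Sum>t=0..<stages d. charge \<omega> t e) / ((3/2) ^ K - 1))"
        using \<open>e < m\<close> nonneg by (intro member_le_sum[where f="\<lambda>e. (\<Sum>t=0..<stages d. charge \<omega> t e) / ((3/2) ^ K - 1)"]) auto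
      finally show ?thesis using True by simp
    qed (use nonneg in \<open>simp add: sum_nonneg\<close>)
  qed
  also have "\<dots> = (\<Sum>e<m. ?E (\<lambda>\<omega>. 1 * (\<Sum>t=0..<stages d. charge \<omega> t e)) / ((3/2) ^ K - 1))"
    using int by (simp add: Bochner_Integration.integral_sum)
  also have "\<dots> \<le> (\<Sum>e<m. 2 / ((3/2) ^ K - 1))"
  proof (intro sum_mono divide_right_mono)
    fix e assume "e \<in> {..<m}"
    have "?E (\<lambda>\<omega>. 1 * (\<Sum>t=0..<stages d. charge \<omega> t e)) \<le> 2 * ?E (\<lambda>\<omega>. 1 * potential \<omega> 0 e)"
      by (rule expected_charge) auto
    also have "\<dots> \<le> 2" using \<open>e \<in> {..<m}\<close> potential_scale_start[of _ 0 e] by simp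
    finally show "?E (\<lambda>\<omega>. 1 * (\<Sum>t=0..<stages d. charge \<omega> t e)) \<le> 2" .
  qed (use gt in simp)
  finally show ?thesis by (simp add: mult.commute)
qed

section \<open>Accuracy of the sampled degrees\<close>

definition resid :: "flips \<Rightarrow> nat \<Rightarrow> nat \<Rightarrow> nat" where
  "resid \<omega> t S = card {e\<in>alive \<omega> t. mem S e}"

text \<open>Between \<open>tau / 4\<close> and \<open>tau\<close> uncovered elements either outcome
  is accurate, the gap that sampling needs. The first half yields progress, the second makes every
  joining set worth its cost.\<close>

definition accurate_at :: "flips \<Rightarrow> nat \<Rightarrow> nat \<Rightarrow> bool" where
  "accurate_at \<omega> t S \<longleftrightarrow> (tau d t \<le> resid \<omega> t S \<longrightarrow> looks_heavy \<omega> t (alive \<omega> t) S) \<and>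
     (looks_heavy \<omega> t (alive \<omega> t) S \<longrightarrow> tau d t \<le> 4 * resid \<omega> t S)"

definition accurate :: "flips \<Rightarrow> bool" where
  "accurate \<omega> \<longleftrightarrow> (\<forall>t<stages d. \<forall>S<n. accurate_at \<omega> t S)"

lemma heard_dense:
  assumes "\<not> sparse d b \<kappa> t"
  shows "heard \<omega> t al S = {e. e < m \<and> e \<in> al \<and> mem S e}"
  using assms by (simp add: heard_def sbits_def)

lemma accurate_at_dense:
  assumes "\<not> sparse d b \<kappa> t"
  shows "accurate_at \<omega> t S"
proof -
  have "heard \<omega> t (alive \<omega> t) S = {e\<in>alive \<omega> t. mem S e}"
    using assms alive_subset by (auto simp: heard_dense)
  then show ?thesis using assms
    by (auto simp: accurate_at_def looks_heavy_def resid_def sbits_def)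
qed

text \<open>With \<open>a\<close> the count from which a set looks heavy, the two Chernoff bounds
  come out as (2/e)^a and (sqrt e / 2)^a; 5/6 is a common bound for the bases.\<close>

lemma tail_constants:
  "exp (-1::real) * 2 \<le> 5/6" "exp (1/2::real) / 2 \<le> 5/6"
proof -
  have "1 + 1 + 1\<^sup>2 / 2 \<le> exp (1::real)" by (rule exp_lower_Taylor_quadratic) simp
  then show "exp (-1::real) * 2 \<le> 5/6" by (simp add: exp_minus field_simps)
  have "exp (1/2::real) ^ 2 = exp 1" by (simp add: exp_of_nat_mult[symmetric])
  also have "\<dots> \<le> (5/3)\<^sup>2" using e_less_272 by (simp add: power2_eq_square)
  finally have "exp (1/2::real) \<le> 5/3" by (rule power2_le_imp_le) simp
  then show "exp (1/2::real) / 2 \<le> 5/6" by simp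
qed

text \<open>(5/6)^4 is less than 1/2; hence the demand \<open>4 * z \<le> a\<close>, which \<kappa>
  \<ge> 8 * z provides.\<close>

lemma tail_power:
  assumes "4 * z \<le> a"
  shows "(5/6::real) ^ a \<le> (1/2) ^ z"
proof -
  have "(5/6::real) ^ a \<le> (5/6) ^ (4 * z)" using assms by (intro power_decreasing) auto
  also have "\<dots> = ((5/6) ^ 4) ^ z" by (rule power_mult)
  also have "\<dots> \<le> (1/2) ^ z" by (intro power_mono) (auto simp: power_numeral_even)
  finally show ?thesis .
qed

text \<open>Each uncovered element of \<open>S\<close> is heard with probability 2^-b, independently
  because elements flip their own coins. Counts at different sets may depend on each other, so one
  set is treated at a time.\<close>

lemma expectation_pow_heard:
  fixes c :: real
  assumes "c \<ge> 0" "t < stages d" "sparse d b \<kappa> t"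
  shows "measure_pmf.expectation (bitfun (elem_slots t) d)
      (\<lambda>y. c ^ card (heard (\<lambda>k. if k \<in> elem_slots t then y k else \<omega> k) t (alive \<omega> t) S)) =
    (1 + (c - 1) * (1/2) ^ b) ^ resid \<omega> t S"
proof -
  let ?E = "{e\<in>alive \<omega> t. mem S e}"
  let ?V = "(\<lambda>e. (t, ENode e)) ` ?E"
  \<comment> \<open>The \<open>SNode\<close> branch is a dummy, as \<open>?V\<close> consists of
    element slots.\<close>
  let ?A = "\<lambda>(v::nat \<times> node) (x::nat \<Rightarrow> bool). \<forall>i<b. x i = odd (port (case snd v of ENode e \<Rightarrow> e | SNode _ \<Rightarrow> 0) S div 2 ^ i)"
  have inj: "inj_on (\<lambda>e. (t, ENode e)) X" for X by (auto simp: inj_on_def)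
  have am: "e < m" if "e \<in> alive \<omega> t" for e using that alive_subset by blast
  have "card (heard (\<lambda>k. if k \<in> elem_slots t then y k else \<omega> k) t (alive \<omega> t) S)
      = card {v\<in>?V. ?A v (y v)}" for y
  proof -
    have "{v\<in>?V. ?A v (y v)} = (\<lambda>e. (t, ENode e)) `
        heard (\<lambda>k. if k \<in> elem_slots t then y k else \<omega> k) t (alive \<omega> t) S"
      using assms(3) am by (auto simp: heard_def sbits_def)
    then show ?thesis by (simp add: card_image[OF inj])
  qed
  moreover have "?V \<subseteq> elem_slots t" using am by auto
  ultimately show ?thesis
    using assms(1) b_le expectation_pow_card[where J="elem_slots t" and V="?V" and a=c and w=d
        and A="?A" and p="(1/2) ^ b"]
    by (simp add: prob_bitvec_prefix resid_def card_image[OF inj])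
qed

text \<open>A binomial count c with mean \<open>resid / 2 ^ b\<close> is compared with
  \<open>a\<close>: the mean is at least 2a if \<open>tau \<le> resid\<close> and below a/2 if
  \<open>4 * resid < tau\<close>. Markov's inequality for (1/2)^c and for 2^c bounds the two
  errors.\<close>

lemma prob_inaccurate_at:
  assumes t: "t < stages d"
  shows "measure_pmf.prob flip_space {\<omega>. \<not> accurate_at \<omega> t S} \<le> 2 * (1/2) ^ z"
proof (cases "sparse d b \<kappa> t")
  case False
  then show ?thesis using accurate_at_dense by simp
next
  case True
  define s where "s = d - t div (d + 1)"
  have ts: "tau d t = 2 ^ s" by (simp add: s_def tau_def)
  have k: "8 * z * 2 ^ b \<le> 2 ^ s"
  proof -
    have "8 * z * 2 ^ b \<le> \<kappa> * 2 ^ b" using kappa by (intro mult_right_mono) auto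
    also have "\<dots> \<le> 2 ^ s" using True by (simp add: sparse_def ts)
    finally show ?thesis .
  qed
  moreover have "2 ^ b < 8 * z * 2 ^ b" using z_pos by simp
  ultimately have "(2::nat) ^ b < 2 ^ s" by linarith
  then have bs: "Suc b \<le> s" by simp
  \<comment> \<open>Both \<open>tau\<close> and 2 * 2^b are powers of two, so the count threshold is
    an exact integer; \<open>bs\<close> keeps the exponent from being truncated.\<close>
  define a :: nat where "a = 2 ^ (s - Suc b)"
  have tau_a: "tau d t = 2 * 2 ^ b * a"
    unfolding ts a_def using bs by (simp add: power_Suc[symmetric] power_add[symmetric] del: power_Suc)
  have "4 * z \<le> a"
  proof -
    have "4 * z * (2 * 2 ^ b) \<le> a * (2 * 2 ^ b)" using k by (simp add: ts[symmetric] tau_a ac_simps)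
    then show ?thesis by simp
  qed
  note tail = tail_power[OF this]
  let ?E = "measure_pmf.expectation :: flips pmf \<Rightarrow> (flips \<Rightarrow> real) \<Rightarrow> real"
  have "measure_pmf.prob flip_space {\<omega>. \<not> accurate_at \<omega> t S}
      = ?E flip_space (indicator {\<omega>. \<not> accurate_at \<omega> t S})" by simp
  also have "\<dots> \<le> ?E flip_space (\<lambda>_. 2 * (1/2) ^ z)"
  proof (rule expectation_bitfun_mono_resample[OF finite_slots slots_subset(2)[OF t]])
    fix \<omega> :: flips
    define o' :: "flips \<Rightarrow> flips" where "o' y = (\<lambda>k. if k \<in> elem_slots t then y k else \<omega> k)" for y
    let ?M = "bitfun (elem_slots t) d"
    have int: "integrable (measure_pmf ?M) f" for f :: "flips \<Rightarrow> real"
      by (intro integrable_bitfun) simp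
    have al: "alive (o' y) t = alive \<omega> t" for y by (rule state_cong) (auto simp: o'_def)
    have res: "resid (o' y) t S = resid \<omega> t S" for y by (simp add: resid_def al)
    define r where "r = resid \<omega> t S"
    define c where "c y = card (heard (o' y) t (alive \<omega> t) S)" for y
    have looks_heavy: "looks_heavy (o' y) t (alive (o' y) t) S \<longleftrightarrow> a \<le> c y" for y
      using True by (simp add: looks_heavy_def sbits_def tau_a al c_def)
    have pow: "?E ?M (\<lambda>y. q ^ c y) = (1 + (q - 1) * (1/2) ^ b) ^ r" if "q \<ge> 0" for q :: real
      using expectation_pow_heard[OF that t True] by (simp add: c_def r_def o'_def)
    have up: "(1 + x) ^ r \<le> exp (real r * x)" if "x \<ge> -1" for x :: real
    proof -
      have "(1 + x) ^ r \<le> exp x ^ r"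
        using that by (intro power_mono) (auto simp: exp_ge_add_one_self)
      then show ?thesis by (simp add: exp_of_nat_mult)
    qed
    have half: "(1/2::real) ^ b \<le> 1" by (simp add: power_le_one)
    show "?E ?M (\<lambda>y. indicator {\<omega>. \<not> accurate_at \<omega> t S} (\<lambda>k. if k \<in> elem_slots t then y k else \<omega> k))
        \<le> 2 * (1/2::real) ^ z"
    proof (cases "tau d t \<le> r")
      case big: True
      have "real (tau d t) \<le> real r" using big by simp
      then have ra: "- (real r * (1/2) ^ b / 2) \<le> - real a" by (simp add: tau_a field_simps power_one_over)
      have "?E ?M (\<lambda>y. indicator {\<omega>. \<not> accurate_at \<omega> t S} (o' y)) \<le> ?E ?M (\<lambda>y. (2::real) ^ a * (1/2) ^ c y)"
      proof (intro integral_mono int)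
        fix y
        show "indicator {\<omega>. \<not> accurate_at \<omega> t S} (o' y) \<le> (2 ^ a * (1/2) ^ c y :: real)"
        proof (cases "a \<le> c y")
          case True
          then show ?thesis using big by (simp add: accurate_at_def looks_heavy res r_def[symmetric])
        next
          case False
          then have "(2::real) ^ c y \<le> 2 ^ a" by (intro power_increasing) auto
          then show ?thesis by (simp add: indicator_def power_one_over field_simps)
        qed
      qed
      also have "\<dots> = 2 ^ a * (1 + (- ((1/2) ^ b / 2))) ^ r"
        using pow[of "1/2"] by simp
      also have "\<dots> \<le> 2 ^ a * exp (real r * (- ((1/2) ^ b / 2)))"
        using half by (intro mult_left_mono up) auto
      also have "\<dots> \<le> 2 ^ a * exp (- real a)" using ra by simp
      also have "\<dots> = (exp (-1) * 2) ^ a"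
        by (simp add: power_mult_distrib exp_of_nat_mult[symmetric])
      also have "\<dots> \<le> (5/6) ^ a" using tail_constants by (intro power_mono) auto
      also have "\<dots> \<le> (1/2) ^ z" by (rule tail)
      also have "\<dots> \<le> 2 * (1/2) ^ z" by simp
      finally show ?thesis by (simp add: o'_def)
    next
      case small: False
      show ?thesis
      proof (cases "4 * r < tau d t")
        case lt: True
        have "real (4 * r) \<le> real (tau d t)" using lt by simp
        then have ra: "real r * (1/2) ^ b \<le> real a / 2" by (simp add: tau_a field_simps power_one_over)
        have "?E ?M (\<lambda>y. indicator {\<omega>. \<not> accurate_at \<omega> t S} (o' y)) \<le> ?E ?M (\<lambda>y. (1/2::real) ^ a * 2 ^ c y)"
        proof (intro integral_mono int)
          fix y
          show "indicator {\<omega>. \<not> accurate_at \<omega> t S} (o' y) \<le> ((1/2) ^ a * 2 ^ c y :: real)"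
          proof (cases "a \<le> c y")
            case True
            then have "(2::real) ^ a \<le> 2 ^ c y" by (intro power_increasing) auto
            then show ?thesis by (simp add: indicator_def power_one_over field_simps)
          next
            case False
            then show ?thesis using small by (simp add: accurate_at_def looks_heavy res r_def[symmetric])
          qed
        qed
        also have "\<dots> = (1/2) ^ a * (1 + (1/2) ^ b) ^ r"
          using pow[of 2] by simp
        also have "\<dots> \<le> (1/2) ^ a * exp (real r * (1/2) ^ b)"
          using half by (intro mult_left_mono up) (auto intro: order_trans[of _ 0])
        also have "\<dots> \<le> (1/2) ^ a * exp (real a / 2)" using ra by simp
        also have "\<dots> = (exp (1/2) / 2) ^ a"
          by (simp add: power_divide exp_of_nat_mult[symmetric])
        also have "\<dots> \<le> (5/6) ^ a" using tail_constants by (intro power_mono) auto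
        also have "\<dots> \<le> (1/2) ^ z" by (rule tail)
        also have "\<dots> \<le> 2 * (1/2) ^ z" by simp
        finally show ?thesis by (simp add: o'_def)
      next
        case False
        have "accurate_at (o' y) t S" for y
          using False small by (simp add: accurate_at_def res r_def[symmetric])
        then show ?thesis by (simp add: o'_def[symmetric])
      qed
    qed
  qed
  finally show ?thesis by simp
qed

lemma prob_inaccurate:
  "measure_pmf.prob flip_space {\<omega>. \<not> accurate \<omega>} \<le> 2 * real n * real (stages d) * (1/2) ^ z"
proof -
  let ?B = "\<lambda>t. \<Union>S<n. {\<omega>. \<not> accurate_at \<omega> t S}"
  have "measure_pmf.prob flip_space {\<omega>. \<not> accurate \<omega>} \<le> measure_pmf.prob flip_space (\<Union>t<stages d. ?B t)"
    by (intro measure_pmf.finite_measure_mono) (auto simp: accurate_def)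
  also have "\<dots> \<le> (\<Sum>t<stages d. measure_pmf.prob flip_space (?B t))"
    by (intro measure_pmf.finite_measure_subadditive_finite) auto
  also have "\<dots> \<le> (\<Sum>t<stages d. \<Sum>S<n. measure_pmf.prob flip_space {\<omega>. \<not> accurate_at \<omega> t S})"
    by (intro sum_mono measure_pmf.finite_measure_subadditive_finite) auto
  also have "\<dots> \<le> (\<Sum>t<stages d. \<Sum>S<n. 2 * (1/2) ^ z)"
    by (intro sum_mono prob_inaccurate_at) auto
  finally show ?thesis by (simp add: ac_simps)
qed

section \<open>Accurate runs\<close>

lemma resid_antimono: "t \<le> t' \<Longrightarrow> resid \<omega> t' S \<le> resid \<omega> t S"
  unfolding resid_def using alive_antimono by (intro card_mono) auto

lemma resid_after_join: "S \<in> joins \<omega> t \<Longrightarrow> resid \<omega> (Suc t) S = 0"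
  by (auto simp: resid_def alive_Suc)

text \<open>Stage \<open>d\<close> of a scale requires \<open>d - d = 0\<close> coins, so a set that
  looked heavy throughout joins with certainty.\<close>

lemma last_stage_joins:
  assumes "S < n" "\<And>j. j \<le> d \<Longrightarrow> looks_heavy \<omega> (s * (d + 1) + j) (alive \<omega> (s * (d + 1) + j)) S"
  shows "S \<in> joins \<omega> (s * (d + 1) + d)"
proof -
  have "s * (d + 1) + d = d + s * (d + 1)" by simp
  then have md: "(s * (d + 1) + d) mod (d + 1) = d"
    by (simp only: mod_mult_self1) simp
  have "looks_heavy \<omega> t' (alive \<omega> t') S" if "s * (d + 1) \<le> t'" "t' \<le> s * (d + 1) + d" for t'
    using that assms(2)[of "t' - s * (d + 1)"] by simp
  then have "S \<in> heavy \<omega> (s * (d + 1) + d)"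
    unfolding mem_heavy_iff md using assms(1) by auto
  then show ?thesis unfolding joins_eq md by simp
qed

lemma scale_bounds:
  assumes "s \<le> d" "j \<le> d"
  shows "s * (d + 1) + j < stages d" "(s * (d + 1) + j) div (d + 1) = s"
proof -
  have "s * (d + 1) \<le> d * (d + 1)" using assms by (intro mult_right_mono) auto
  then show "s * (d + 1) + j < stages d" using assms by (simp add: stages_def)
  show "(s * (d + 1) + j) div (d + 1) = s"
    using assms by (intro div_nat_eqI) auto
qed

lemma tau_scale: "s \<le> d \<Longrightarrow> j \<le> d \<Longrightarrow> tau d (s * (d + 1) + j) = 2 ^ (d - s)"
  unfolding tau_def by (subst scale_bounds) auto

lemma stage_decomp:
  assumes "t < stages d"
  obtains s j where "s \<le> d" "j \<le> d" "t = s * (d + 1) + j"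
proof
  have "t div (d + 1) < d + 1" using assms unfolding stages_def by (rule less_mult_imp_div_less)
  then show "t div (d + 1) \<le> d" by simp
  show "t mod (d + 1) \<le> d" by (simp add: less_Suc_eq_le[symmetric])
  show "t = t div (d + 1) * (d + 1) + t mod (d + 1)" by (rule div_mult_mod_eq[symmetric])
qed

text \<open>The bound is the threshold of the preceding scale. A set above it would have been above
  it in that whole scale, hence would have looked heavy throughout, joined, and been left with no
  uncovered element. In scale 0 the degree bound applies.\<close>

lemma resid_scale_start:
  assumes "accurate \<omega>" "S < n" "s \<le> d"
  shows "resid \<omega> (s * (d + 1)) S \<le> 2 * 2 ^ (d - s)"
proof (cases s)
  case 0
  have "{e \<in> alive \<omega> 0. mem S e} = {e. e < m \<and> mem S e}" by auto
  then have "resid \<omega> 0 S \<le> 2 ^ d" using set_deg[OF assms(2)] by (simp add: resid_def)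
  then show ?thesis using 0 by simp
next
  case (Suc r)
  show ?thesis
  proof (rule ccontr)
    assume neg: "\<not> ?thesis"
    have pow: "2 * 2 ^ (d - s) = (2::nat) ^ (d - r)"
      using Suc assms(3) by (simp add: power_Suc[symmetric] Suc_diff_Suc del: power_Suc)
    have "looks_heavy \<omega> (r * (d + 1) + j) (alive \<omega> (r * (d + 1) + j)) S" if "j \<le> d" for j
    proof -
      have "resid \<omega> (s * (d + 1)) S \<le> resid \<omega> (r * (d + 1) + j) S"
        using that Suc by (intro resid_antimono) simp
      then have "tau d (r * (d + 1) + j) \<le> resid \<omega> (r * (d + 1) + j) S"
      proof -
        have "tau d (r * (d + 1) + j) = 2 ^ (d - r)"
          by (rule tau_scale) (use that Suc assms(3) in auto)
        with \<open>resid \<omega> (s * (d + 1)) S \<le> resid \<omega> (r * (d + 1) + j) S\<close> show ?thesis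
          using neg pow by linarith
      qed
      moreover have "accurate_at \<omega> (r * (d + 1) + j) S"
        using assms scale_bounds(1)[of r j] Suc that by (simp add: accurate_def)
      ultimately show ?thesis by (simp add: accurate_at_def)
    qed
    then have "S \<in> joins \<omega> (r * (d + 1) + d)" using assms(2) by (intro last_stage_joins)
    then have "resid \<omega> (Suc (r * (d + 1) + d)) S = 0" by (rule resid_after_join)
    moreover have "Suc (r * (d + 1) + d) = s * (d + 1)" using Suc by simp
    ultimately show False using neg by simp
  qed
qed

lemma resid_le:
  assumes "accurate \<omega>" "S < n" "t < stages d"
  shows "resid \<omega> t S \<le> 2 * tau d t"
proof -
  obtain s j where sj: "s \<le> d" "j \<le> d" "t = s * (d + 1) + j" using stage_decomp[OF assms(3)] .
  have "resid \<omega> t S \<le> resid \<omega> (s * (d + 1)) S" using sj by (intro resid_antimono) simp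
  then show ?thesis
    using resid_scale_start[OF assms(1,2) sj(1)] sj tau_scale by simp
qed

text \<open>In the last scale the threshold is 1 and the counts are exact, so for every outcome of
  the coins a set with a remaining uncovered element looks heavy in all stages and joins in the
  last.\<close>

lemma alive_end:
  assumes sparse: "\<And>t. sparse d b \<kappa> t \<Longrightarrow> 1 < tau d t"
  shows "alive \<omega> (stages d) = {}"
proof (rule ccontr)
  assume "alive \<omega> (stages d) \<noteq> {}"
  then obtain e where e: "e \<in> alive \<omega> (stages d)" by auto
  then obtain S where S: "S < n" "mem S e" using coverable alive_subset by blast
  have st: "stages d = Suc (d * (d + 1) + d)" by (simp add: stages_def)
  have "looks_heavy \<omega> (d * (d + 1) + j) (alive \<omega> (d * (d + 1) + j)) S" if "j \<le> d" for j
  proof -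
    let ?t = "d * (d + 1) + j"
    have tau1: "tau d ?t = 1" using that tau_scale[of d j] by simp
    then have dense: "\<not> sparse d b \<kappa> ?t" using sparse[of ?t] by auto
    have "e \<in> alive \<omega> ?t" using e alive_antimono[of ?t "stages d" \<omega>] that st by auto
    then have "e \<in> heard \<omega> ?t (alive \<omega> ?t) S"
      unfolding heard_dense[OF dense] using S alive_subset by blast
    moreover have "finite (heard \<omega> ?t (alive \<omega> ?t) S)" by (simp add: heard_def)
    ultimately have "card (heard \<omega> ?t (alive \<omega> ?t) S) > 0" by (auto simp: card_gt_0_iff)
    then show ?thesis unfolding looks_heavy_def tau1 by simp
  qed
  then have "S \<in> joins \<omega> (d * (d + 1) + d)" using S by (intro last_stage_joins)
  then show False using e S unfolding st by (auto simp: alive_Suc)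
qed

text \<open>Double counting of the pairs of a joining set and an uncovered element in it; by
  accuracy each joining set accounts for at least \<open>tau / 4\<close> of them.\<close>

lemma tau_card_joins_le:
  assumes "accurate \<omega>" "t < stages d"
  shows "tau d t * card (joins \<omega> t) \<le> 4 * (\<Sum>e\<in>alive \<omega> t. hits \<omega> t e)"
proof -
  have "tau d t * card (joins \<omega> t) = (\<Sum>S\<in>joins \<omega> t. tau d t)" by simp
  also have "\<dots> \<le> (\<Sum>S\<in>joins \<omega> t. 4 * resid \<omega> t S)"
  proof (rule sum_mono)
    fix S assume S: "S \<in> joins \<omega> t"
    then have "S < n" "looks_heavy \<omega> t (alive \<omega> t) S"
      using subsetD[OF joins_subset S] subsetD[OF joins_subset_heavy S] by (auto simp: heavy_eq)
    then show "tau d t \<le> 4 * resid \<omega> t S"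
      using assms by (simp add: accurate_def accurate_at_def)
  qed
  also have "\<dots> = 4 * (\<Sum>S\<in>joins \<omega> t. card {e\<in>alive \<omega> t. mem S e})"
    by (simp add: resid_def sum_distrib_left)
  also have "(\<Sum>S\<in>joins \<omega> t. card {e\<in>alive \<omega> t. mem S e}) = (\<Sum>e\<in>alive \<omega> t. hits \<omega> t e)"
    unfolding hits_def by (rule sum_multicount_gen) auto
  finally show ?thesis .
qed

text \<open>The comparison with the optimum: each set of \<open>C\<close> has at most
  \<open>2 * tau\<close> uncovered elements left, and together these sets contain all of
  them.\<close>

lemma card_alive_le:
  assumes "accurate \<omega>" "t < stages d" "is_cover mem n m C"
  shows "card (alive \<omega> t) \<le> 2 * tau d t * card C"
proof -
  have C: "C \<subseteq> {..<n}" "finite C" using assms(3) finite_subset[of C "{..<n}"] by (auto simp: is_cover_def)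
  have "alive \<omega> t \<subseteq> (\<Union>S\<in>C. {e\<in>alive \<omega> t. mem S e})"
    using assms(3) alive_subset[of \<omega> t] by (fastforce simp: is_cover_def)
  then have "card (alive \<omega> t) \<le> card (\<Union>S\<in>C. {e\<in>alive \<omega> t. mem S e})"
    using C by (intro card_mono) auto
  also have "\<dots> \<le> (\<Sum>S\<in>C. resid \<omega> t S)" unfolding resid_def by (rule card_UN_le) (fact C)
  also have "\<dots> \<le> (\<Sum>S\<in>C. 2 * tau d t)"
    using C assms by (intro sum_mono resid_le) auto
  finally show ?thesis by (simp add: ac_simps)
qed

section \<open>Expected size of the cover\<close>

definition chosen :: "flips \<Rightarrow> nat set" where
  "chosen \<omega> = (\<Union>t<stages d. joins \<omega> t)"

lemma chosen_subset: "chosen \<omega> \<subseteq> {..<n}"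
  using joins_subset by (auto simp: chosen_def)

lemma card_chosen_le_n: "card (chosen \<omega>) \<le> n"
  using card_mono[OF _ chosen_subset] by simp

lemma covered_by_joins:
  assumes "e < m" "e \<notin> alive \<omega> t"
  shows "\<exists>t'<t. \<exists>S\<in>joins \<omega> t'. mem S e"
  using assms
proof (induction t)
  case (Suc t)
  then show ?case by (cases "e \<in> alive \<omega> t") (auto simp: alive_Suc less_Suc_eq)
qed simp

lemma chosen_cover:
  assumes "\<And>t. sparse d b \<kappa> t \<Longrightarrow> 1 < tau d t"
  shows "is_cover mem n m (chosen \<omega>)"
  unfolding is_cover_def
proof (intro conjI allI impI chosen_subset)
  fix e assume "e < m"
  then show "\<exists>S\<in>chosen \<omega>. mem S e"
    using covered_by_joins[of e \<omega> "stages d"] alive_end[OF assms] by (auto simp: chosen_def)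
qed

text \<open>In an accurate run the uncovered elements at the start of a scale with threshold \<open>\<tau>\<close> number at
  most \<open>2 * \<tau> * card C\<close>, and each of them pays for \<open>O(1 / \<tau>)\<close> sets in expectation. The indicator \<open>Z\<close>
  keeps only this consequence of accuracy, which is known before the scale begins and therefore does
  not disturb the supermartingale.\<close>

lemma expected_chosen:
  assumes C: "is_cover mem n m C"
  shows "measure_pmf.expectation flip_space (\<lambda>\<omega>. real (card (chosen \<omega>)))
    \<le> 32 * real (d + 1) * real (card C) + real n * measure_pmf.prob flip_space {\<omega>. \<not> accurate \<omega>}"
proof -
  note int = integrable_bitfun[OF finite_slots]
  let ?E = "measure_pmf.expectation flip_space"
  define st where "st s = s * (d + 1)" for s
  define Z where "Z s e \<omega> = (if e \<in> alive \<omega> (st s) \<and> card (alive \<omega> (st s)) \<le> 2 * 2 ^ (d - s) * card C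
      then 1 else 0 :: real)" for s e \<omega>
  \<comment> \<open>The factor 8 combines \<open>tau \<le> 4 * resid\<close> with
    \<open>hits \<le> 2 * charge\<close>.\<close>
  define part where "part s \<omega> = (\<Sum>e<m. 8 / 2 ^ (d - s) * (Z s e \<omega> * (\<Sum>t=st s..<st (Suc s). charge \<omega> t e)))" for s \<omega>
  have Z_nonneg: "Z s e \<omega> \<ge> 0" for s e \<omega> by (simp add: Z_def)
  have charge_sum_nonneg: "(\<Sum>t\<in>X. charge \<omega> t e) \<ge> 0" for X \<omega> e by (simp add: charge_nonneg sum_nonneg)
  have part_nonneg: "part s \<omega> \<ge> 0" for s \<omega>
    unfolding part_def using Z_nonneg charge_sum_nonneg by (intro sum_nonneg) simp
  have accurate_part: "real (card (\<Union>t\<in>{st s..<st (Suc s)}. joins \<omega> t)) \<le> part s \<omega>"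
    if "accurate \<omega>" "s \<le> d" for \<omega> s
  proof -
    have t: "t < stages d" "tau d t = 2 ^ (d - s)" if "t \<in> {st s..<st (Suc s)}" for t
    proof -
      define j where "j = t - st s"
      have j: "t = s * (d + 1) + j" "j \<le> d" using that by (auto simp: st_def j_def)
      show "t < stages d" unfolding j(1) by (rule scale_bounds) (fact \<open>s \<le> d\<close> j)+
      show "tau d t = 2 ^ (d - s)" unfolding j(1) by (rule tau_scale) (fact \<open>s \<le> d\<close> j)+
    qed
    have "st s \<in> {st s..<st (Suc s)}" by (simp add: st_def)
    then have small: "card (alive \<omega> (st s)) \<le> 2 * 2 ^ (d - s) * card C"
      using card_alive_le[OF that(1) t(1) C, of "st s"] t(2)[of "st s"] by simp
    have "real (card (\<Union>t\<in>{st s..<st (Suc s)}. joins \<omega> t)) \<le> real (\<Sum>t\<in>{st s..<st (Suc s)}. card (joins \<omega> t))"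
      by (intro of_nat_mono card_UN_le) simp
    also have "\<dots> = (\<Sum>t\<in>{st s..<st (Suc s)}. real (card (joins \<omega> t)))" by simp
    also have "\<dots> \<le> (\<Sum>t\<in>{st s..<st (Suc s)}. \<Sum>e<m. 8 / 2 ^ (d - s) * (Z s e \<omega> * charge \<omega> t e))"
    proof (rule sum_mono)
      fix u assume u: "u \<in> {st s..<st (Suc s)}"
      have sub: "alive \<omega> u \<subseteq> alive \<omega> (st s)" using u by (intro alive_antimono) simp
      have "2 ^ (d - s) * card (joins \<omega> u) \<le> 4 * (\<Sum>e\<in>alive \<omega> u. hits \<omega> u e)"
        using tau_card_joins_le[OF that(1) t(1)[OF u]] t(2)[OF u] by simp
      then have "real (2 ^ (d - s) * card (joins \<omega> u)) \<le> real (4 * (\<Sum>e\<in>alive \<omega> u. hits \<omega> u e))"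
        by (rule of_nat_mono)
      also have "\<dots> = 4 * (\<Sum>e\<in>alive \<omega> u. real (hits \<omega> u e))" by simp
      also have "\<dots> \<le> 4 * (\<Sum>e\<in>alive \<omega> u. 2 * (Z s e \<omega> * charge \<omega> u e))"
        using hits_le_charge small sub by (intro mult_left_mono sum_mono) (auto simp: Z_def)
      also have "\<dots> \<le> 4 * (\<Sum>e<m. 2 * (Z s e \<omega> * charge \<omega> u e))"
        using alive_subset Z_nonneg charge_nonneg by (intro mult_left_mono sum_mono2) auto
      finally have "real (card (joins \<omega> u)) \<le> 8 / 2 ^ (d - s) * (\<Sum>e<m. Z s e \<omega> * charge \<omega> u e)"
        by (simp add: field_simps sum_distrib_left[symmetric])
      then show "real (card (joins \<omega> u)) \<le> (\<Sum>e<m. 8 / 2 ^ (d - s) * (Z s e \<omega> * charge \<omega> u e))"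
        by (simp add: sum_distrib_left)
    qed
    also have "\<dots> = part s \<omega>"
      unfolding part_def sum_distrib_left by (rule sum.swap)
    finally show ?thesis .
  qed
  have chosen_eq: "chosen \<omega> = (\<Union>s<d + 1. \<Union>t\<in>{st s..<st (Suc s)}. joins \<omega> t)" for \<omega>
  proof -
    have "{..<stages d} = (\<Union>s<d + 1. {st s..<st (Suc s)})"
    proof (intro equalityI subsetI)
      fix t assume "t \<in> {..<stages d}"
      then obtain s j where "s \<le> d" "j \<le> d" "t = s * (d + 1) + j" using stage_decomp by auto
      then have "s < d + 1" "t \<in> {st s..<st (Suc s)}" by (auto simp: st_def)
      then show "t \<in> (\<Union>s<d + 1. {st s..<st (Suc s)})" by blast
    next
      fix t assume "t \<in> (\<Union>s<d + 1. {st s..<st (Suc s)})"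
      then obtain s where "s \<le> d" "st s \<le> t" "t < st (Suc s)" by (auto simp: less_Suc_eq_le)
      then show "t \<in> {..<stages d}" using scale_bounds(1)[of s "t - st s"] by (simp add: st_def)
    qed
    then show ?thesis unfolding chosen_def by blast
  qed
  \<comment> \<open>An inaccurate run is charged the trivial bound \<open>n\<close>; its small
    probability makes up for it.\<close>
  have pointwise: "real (card (chosen \<omega>)) \<le> (\<Sum>s<d + 1. part s \<omega>) + real n * indicator {\<omega>. \<not> accurate \<omega>} \<omega>" for \<omega>
  proof (cases "accurate \<omega>")
    case True
    have "real (card (chosen \<omega>)) \<le> real (\<Sum>s<d + 1. card (\<Union>t\<in>{st s..<st (Suc s)}. joins \<omega> t))"
      unfolding chosen_eq by (intro of_nat_mono card_UN_le) simp
    also have "\<dots> \<le> (\<Sum>s<d + 1. part s \<omega>)"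
      unfolding of_nat_sum using accurate_part[OF True] by (intro sum_mono) simp
    finally show ?thesis using True by simp
  next
    case False
    then show ?thesis using card_chosen_le_n[of \<omega>] part_nonneg by (simp add: sum_nonneg add_increasing)
  qed
  have part_bound: "?E (part s) \<le> 32 * real (card C)" if "s < d + 1" for s
  proof -
    have "?E (part s) = (\<Sum>e<m. 8 / 2 ^ (d - s) * ?E (\<lambda>\<omega>. Z s e \<omega> * (\<Sum>t=st s..<st (Suc s). charge \<omega> t e)))"
      unfolding part_def by (subst Bochner_Integration.integral_sum) (auto intro!: int)
    also have "\<dots> \<le> (\<Sum>e<m. 8 / 2 ^ (d - s) * (2 * ?E (\<lambda>\<omega>. Z s e \<omega> * potential \<omega> (st s) e)))"
    proof (intro sum_mono mult_left_mono expected_charge)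
      fix e :: nat and \<omega> \<omega>' :: flips
      assume "\<And>t v. t < st s \<Longrightarrow> \<omega> (t, v) = \<omega>' (t, v)"
      then show "Z s e \<omega> = Z s e \<omega>'" using state_cong(1)[of "st s" \<omega> \<omega>'] by (simp add: Z_def)
    qed (use that Z_nonneg scale_bounds(1)[of s d] in \<open>auto simp: st_def\<close>)
    also have "\<dots> = 16 / 2 ^ (d - s) * ?E (\<lambda>\<omega>. \<Sum>e<m. Z s e \<omega> * potential \<omega> (st s) e)"
      using int by (simp add: Bochner_Integration.integral_sum sum_distrib_left)
    also have "\<dots> \<le> 16 / 2 ^ (d - s) * ?E (\<lambda>_. 2 * 2 ^ (d - s) * real (card C))"
    proof (intro mult_left_mono integral_mono int)
      fix \<omega>
      show "(\<Sum>e<m. Z s e \<omega> * potential \<omega> (st s) e) \<le> 2 * 2 ^ (d - s) * real (card C)"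
      proof (cases "card (alive \<omega> (st s)) \<le> 2 * 2 ^ (d - s) * card C")
        case True
        then have "real (card (alive \<omega> (st s))) \<le> real (2 * 2 ^ (d - s) * card C)" by (rule of_nat_mono)
        moreover have "(\<Sum>e<m. Z s e \<omega> * potential \<omega> (st s) e) = (\<Sum>e\<in>alive \<omega> (st s). 1)"
          using True alive_subset
          by (intro sum.mono_neutral_cong_right) (auto simp: Z_def st_def potential_scale_start[simplified])
        ultimately show ?thesis by simp
      qed (simp add: Z_def)
    qed auto
    \<comment> \<open>32 = 8 * 2 * 2, from \<open>part\<close>, from \<open>expected_charge\<close>
      and from the bound on the uncovered elements.\<close>
    also have "\<dots> = 32 * real (card C)" by simp
    finally show ?thesis .
  qed
  have "?E (\<lambda>\<omega>. real (card (chosen \<omega>))) \<le> ?E (\<lambda>\<omega>. (\<Sum>s<d + 1. part s \<omega>) + real n * indicator {\<omega>. \<not> accurate \<omega>} \<omega>)"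
    by (intro integral_mono int pointwise)
  also have "\<dots> = ?E (\<lambda>\<omega>. \<Sum>s<d + 1. part s \<omega>) + real n * ?E (indicator {\<omega>. \<not> accurate \<omega>})"
    using int by (subst Bochner_Integration.integral_add) auto
  also have "?E (\<lambda>\<omega>. \<Sum>s<d + 1. part s \<omega>) = (\<Sum>s<d + 1. ?E (part s))"
    by (rule Bochner_Integration.integral_sum) (rule int)
  also have "\<dots> \<le> (\<Sum>s<d + 1. 32 * real (card C))"
    using part_bound by (intro sum_mono) simp
  finally show ?thesis by (simp add: algebra_simps)
qed

end

section \<open>The distributed algorithm\<close>

definition logdeg :: "nat \<Rightarrow> nat" where
  "logdeg \<Delta> = nat \<lceil>log 2 (real \<Delta>)\<rceil>"

text \<open>2^slack is 16 * 4^(A L) * 4^d. With \<open>A * L\<close> at least the logarithm of n +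
  1, it beats the union bound over all sets and stages with a factor 2 (n + 1) to spare.\<close>

definition slack :: "nat \<Rightarrow> nat \<Rightarrow> nat \<Rightarrow> nat" where
  "slack A d L = 2 * (A * L + d + 2)"

definition pushes :: "nat \<Rightarrow> nat \<Rightarrow> nat \<Rightarrow> tape \<Rightarrow> nat \<Rightarrow> nat \<Rightarrow> bool" where
  "pushes d b \<kappa> x t p \<longleftrightarrow> (\<forall>i<sbits d b \<kappa> t. x (prod_encode (t, i)) = odd (p div 2 ^ i))"

definition silent :: "history \<Rightarrow> bool" where
  "silent h \<longleftrightarrow> (\<forall>f\<in>set h. \<forall>q. f q = None)"

definition seems_heavy :: "nat \<Rightarrow> nat \<Rightarrow> nat \<Rightarrow> history \<Rightarrow> nat \<Rightarrow> bool" where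
  "seems_heavy d b \<kappa> h t \<longleftrightarrow> tau d t \<le> 2 * 2 ^ sbits d b \<kappa> t * card {q. (h ! (2 * t)) q \<noteq> None}"

text \<open>Heaviness in the earlier stages is recomputed from the recorded messages, as nodes keep
  no state besides their histories.\<close>

definition set_joins :: "nat \<Rightarrow> nat \<Rightarrow> nat \<Rightarrow> tape \<Rightarrow> history \<Rightarrow> nat \<Rightarrow> bool" where
  "set_joins d b \<kappa> x h t \<longleftrightarrow> (\<forall>t'\<in>{t - t mod (d + 1)..t}. seems_heavy d b \<kappa> h t') \<and>
     (\<forall>i<d - t mod (d + 1). x (prod_encode (t, i)))"

text \<open>Stage \<open>t\<close> takes the rounds \<open>2 * t\<close>, in which uncovered elements contact sets, and \<open>2 * t + 1\<close>, in which
  joining sets inform their elements. An element is uncovered iff it has never received a message.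
  In a dense stage all uncovered elements have just contacted the set, so it need not inform others.\<close>

definition cover_send :: "nat \<Rightarrow> nat \<Rightarrow> nat \<Rightarrow> bool \<Rightarrow> tape \<Rightarrow> history \<Rightarrow> nat \<Rightarrow> bool" where
  "cover_send d b \<kappa> is_set x h p \<longleftrightarrow> (let t = length h div 2 in
     if is_set
     then odd (length h) \<and> set_joins d b \<kappa> x h t \<and> (sparse d b \<kappa> t \<or> (h ! (2 * t)) p \<noteq> None)
     else even (length h) \<and> silent h \<and> pushes d b \<kappa> x t p)"

text \<open>Messages are empty, only their presence informs. \<Delta> = 0 is a case of its own,
  since even \<open>stages 0\<close> is positive while the round bound is then 0.\<close>

definition cover_alg :: "nat \<Rightarrow> alg" where
  "cover_alg A = \<lparr>
     rounds = (\<lambda>\<Delta> L. if \<Delta> = 0 then 0 else 2 * stages (logdeg \<Delta>)),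
     send = (\<lambda>(is_set, dg, \<Delta>, L) x h p. let d = logdeg \<Delta> in
       if cover_send d (d div 2) (8 * slack A d L) is_set x h p then Some [] else None),
     outp = (\<lambda>(is_set, dg, \<Delta>, L) x h. let d = logdeg \<Delta> in
       0 < \<Delta> \<and> (\<exists>t<stages d. set_joins d (d div 2) (8 * slack A d L) x h t)) \<rparr>"

lemma le_two_power_logdeg:
  assumes "\<Delta> > 0" shows "\<Delta> \<le> 2 ^ logdeg \<Delta>"
proof -
  have "log 2 (real \<Delta>) \<le> real (logdeg \<Delta>)" unfolding logdeg_def by linarith
  then have "real \<Delta> \<le> 2 powr real (logdeg \<Delta>)" using assms by (simp add: log_le_iff)
  then have "real \<Delta> \<le> real (2 ^ logdeg \<Delta>)" by (simp add: powr_realpow)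
  then show ?thesis by (simp only: of_nat_le_iff)
qed

lemma logdeg_le:
  assumes "\<Delta> > 0" shows "real (logdeg \<Delta>) \<le> log 2 (real \<Delta>) + 1"
proof -
  have "log 2 (real \<Delta>) \<ge> 0" using assms by simp
  then show ?thesis unfolding logdeg_def by linarith
qed

lemma two_power_logdeg_le:
  assumes "\<Delta> > 0" shows "(2::real) ^ logdeg \<Delta> \<le> 2 * real \<Delta>"
proof -
  have "(2::real) powr real (logdeg \<Delta>) \<le> 2 powr (log 2 (real \<Delta>) + 1)"
    using logdeg_le[OF assms] by (intro powr_mono) auto
  also have "\<dots> = 2 * real \<Delta>" using assms by (simp add: powr_add)
  finally show ?thesis by (simp add: powr_realpow)
qed

lemma finite_covers: "finite {C. is_cover mem n m C}"
  by (rule finite_subset[of _ "Pow {..<n}"]) (auto simp: is_cover_def)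

lemma obtain_opt_cover:
  assumes "is_cover mem n m C0"
  obtains C where "is_cover mem n m C" "card C = opt_cover mem n m"
proof -
  have "opt_cover mem n m \<in> card ` {C. is_cover mem n m C}"
    unfolding opt_cover_def using assms finite_covers by (intro Min_in) auto
  then show ?thesis using that by auto
qed

lemma real_stages: "real (stages d) = (real (d + 1))\<^sup>2"
  unfolding stages_def power2_eq_square by (rule of_nat_mult)

lemma Suc_le_two_power: "d + 1 \<le> (2::nat) ^ d"
  by (induction d) auto

declare hist.simps(2) [simp del]

section \<open>The network as an instance of the sampled process\<close>

locale cover_network =
  fixes n m :: nat and mem :: "nat \<Rightarrow> nat \<Rightarrow> bool" and pn :: "node \<Rightarrow> nat \<Rightarrow> node"
    and L A :: nat
  assumes ports: "port_numbering mem n m pn"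
    and coverable: "e < m \<Longrightarrow> \<exists>S<n. mem S e"
    and n_pos: "0 < n" and maxdeg_pos: "0 < maxdeg mem n m"
begin

definition "ldeg = logdeg (maxdeg mem n m)"
definition "half = ldeg div 2"
definition "prec = slack A ldeg L"
definition "port e S = bport mem n m pn (ENode e) (SNode S)"

lemma nbrs_SNode: "S < n \<Longrightarrow> nbrs mem n m (SNode S) = ENode ` {e. e < m \<and> mem S e}"
proof -
  assume "S < n"
  have "u \<in> nbrs mem n m (SNode S) \<longleftrightarrow> u \<in> ENode ` {e. e < m \<and> mem S e}" for u
    using \<open>S < n\<close> by (cases u) (auto simp: nbrs_def)
  then show ?thesis by blast
qed

lemma nbrs_ENode: "e < m \<Longrightarrow> nbrs mem n m (ENode e) = SNode ` {S. S < n \<and> mem S e}"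
proof -
  assume "e < m"
  have "u \<in> nbrs mem n m (ENode e) \<longleftrightarrow> u \<in> SNode ` {S. S < n \<and> mem S e}" for u
    using \<open>e < m\<close> by (cases u) (auto simp: nbrs_def)
  then show ?thesis by blast
qed

lemma deg_SNode: "S < n \<Longrightarrow> deg mem n m (SNode S) = card {e. e < m \<and> mem S e}"
  by (simp add: deg_def nbrs_SNode card_image inj_on_def)

lemma deg_ENode: "e < m \<Longrightarrow> deg mem n m (ENode e) = card {S. S < n \<and> mem S e}"
  by (simp add: deg_def nbrs_ENode card_image inj_on_def)

lemma finite_nodes: "finite (nodes n m)"
  by (simp add: nodes_def)

lemma SNode_in_nodes [simp]: "SNode S \<in> nodes n m \<longleftrightarrow> S < n"
  and ENode_in_nodes [simp]: "ENode e \<in> nodes n m \<longleftrightarrow> e < m"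
  by (auto simp: nodes_def)

lemma deg_le: "v \<in> nodes n m \<Longrightarrow> deg mem n m v \<le> 2 ^ ldeg"
proof -
  assume "v \<in> nodes n m"
  then have "deg mem n m v \<le> maxdeg mem n m"
    unfolding maxdeg_def using finite_nodes by (intro Max_ge) auto
  then show ?thesis using le_two_power_logdeg[OF maxdeg_pos] by (simp add: ldeg_def)
qed

sublocale sampled_cover n m mem port ldeg half "8 * prec" prec
proof
  show "card {S. S < n \<and> mem S e} \<le> 2 ^ ldeg" if "e < m" for e
    using deg_le[of "ENode e"] that by (simp add: deg_ENode)
  show "card {e. e < m \<and> mem S e} \<le> 2 ^ ldeg" if "S < n" for S
    using deg_le[of "SNode S"] that by (simp add: deg_SNode)
qed (use coverable in \<open>auto simp: prec_def slack_def half_def\<close>)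

lemma sparse_tau: "sparse ldeg half (8 * prec) t \<Longrightarrow> 1 < tau ldeg t"
proof -
  assume "sparse ldeg half (8 * prec) t"
  then have "8 * (prec * 2 ^ half) \<le> tau ldeg t" by (simp add: sparse_def mult.assoc)
  moreover have "1 * 1 \<le> prec * 2 ^ half" using z_pos by (intro mult_le_mono) auto
  ultimately show ?thesis by linarith
qed

lemma ex_port:
  assumes "v \<in> nodes n m" "u \<in> nbrs mem n m v"
  shows "bport mem n m pn v u < deg mem n m v" "pn v (bport mem n m pn v u) = u"
proof -
  have bij: "bij_betw (pn v) {..<deg mem n m v} (nbrs mem n m v)"
    using ports assms by (simp add: port_numbering_def)
  then have "u \<in> pn v ` {..<deg mem n m v}" using assms(2) by (simp add: bij_betw_def)
  then obtain p where p: "p < deg mem n m v" "pn v p = u" by auto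
  then have "bport mem n m pn v u = p"
    unfolding bport_def using bij
    by (intro the_equality) (auto simp: bij_betw_def inj_on_def)
  then show "bport mem n m pn v u < deg mem n m v" "pn v (bport mem n m pn v u) = u" using p by auto
qed

lemma pn_nbr:
  assumes "v \<in> nodes n m" "p < deg mem n m v"
  shows "pn v p \<in> nbrs mem n m v" "bport mem n m pn v (pn v p) = p"
proof -
  have bij: "bij_betw (pn v) {..<deg mem n m v} (nbrs mem n m v)"
    using ports assms by (simp add: port_numbering_def)
  then show "pn v p \<in> nbrs mem n m v" using assms by (auto simp: bij_betw_def)
  show "bport mem n m pn v (pn v p) = p"
    unfolding bport_def using bij assms
    by (intro the_equality) (auto simp: bij_betw_def inj_on_def)
qed

section \<open>Simulation of the process by message histories\<close>

context
  fixes tp :: "node \<Rightarrow> tape"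
begin

definition "\<omega> = tape_bits (stages ldeg) ldeg (nodes n m) tp"

abbreviation "H \<equiv> hist (cover_alg A) mem n m pn L tp"

abbreviation "sends r v p \<equiv>
  cover_send ldeg half (8 * prec) (case v of SNode _ \<Rightarrow> True | ENode _ \<Rightarrow> False) (tp v) (H r v) p"

lemma send_eq:
  "send (cover_alg A) (linp mem n m L v) (tp v) (H r v) p = (if sends r v p then Some [] else None)"
  by (simp add: cover_alg_def linp_def ldeg_def half_def prec_def Let_def)

lemma length_H [simp]: "length (H r v) = r"
  by (induction r) (auto simp: hist.simps)

lemma H_nth:
  assumes "r' < r"
  shows "(H r v ! r') q \<noteq> None \<longleftrightarrow> q < deg mem n m v \<and> sends r' (pn v q) (bport mem n m pn (pn v q) v)"
  using assms
proof (induction r)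
  case (Suc r)
  then show ?case by (cases "r' = r") (auto simp: hist.simps nth_append send_eq)
qed simp

lemma sends_ENode:
  "cover_send ldeg half (8 * prec) False (tp (ENode e)) (H r (ENode e)) p \<longleftrightarrow> even r \<and> silent (H r (ENode e)) \<and> pushes ldeg half (8 * prec) (tp (ENode e)) (r div 2) p"
  by (simp add: cover_send_def)

lemma sends_SNode:
  "cover_send ldeg half (8 * prec) True (tp (SNode S)) (H r (SNode S)) p \<longleftrightarrow> odd r \<and> set_joins ldeg half (8 * prec) (tp (SNode S)) (H r (SNode S)) (r div 2) \<and>
     (sparse ldeg half (8 * prec) (r div 2) \<or> (H r (SNode S) ! (2 * (r div 2))) p \<noteq> None)"
  by (simp add: cover_send_def Let_def)

lemma sbits_le: "sbits ldeg half k t \<le> ldeg"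
  by (auto simp: sbits_def half_def)

lemma pushes_iff:
  assumes "t < stages ldeg" "e < m"
  shows "pushes ldeg half (8 * prec) (tp (ENode e)) t p \<longleftrightarrow>
    (\<forall>i<sbits ldeg half (8 * prec) t. \<omega> (t, ENode e) i = odd (p div 2 ^ i))"
  using assms sbits_le[of "8 * prec" t] by (auto simp: pushes_def \<omega>_def tape_bits_def)

text \<open>The invariant of the simulation: silence tells an element correctly whether it is still
  uncovered.\<close>

definition synced :: "nat \<Rightarrow> bool" where
  "synced t \<longleftrightarrow> (\<forall>e<m. silent (H (2 * t) (ENode e)) \<longleftrightarrow> e \<in> alive \<omega> t)"

lemma hears_iff:
  assumes "synced t" "t < stages ldeg" "S < n" "2 * t < r"
  shows "(H r (SNode S) ! (2 * t)) q \<noteq> None \<longleftrightarrow>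
    q < deg mem n m (SNode S) \<and> (\<exists>e\<in>heard \<omega> t (alive \<omega> t) S. pn (SNode S) q = ENode e)"
proof (cases "q < deg mem n m (SNode S)")
  case True
  then obtain e where e: "e < m" "mem S e" "pn (SNode S) q = ENode e"
    using pn_nbr(1)[of "SNode S" q] assms(3) by (auto simp: nbrs_SNode)
  have "(H r (SNode S) ! (2 * t)) q \<noteq> None \<longleftrightarrow> sends (2 * t) (ENode e) (port e S)"
    unfolding H_nth[OF assms(4)] using True e by (simp add: port_def)
  also have "\<dots> \<longleftrightarrow> e \<in> heard \<omega> t (alive \<omega> t) S"
    using e assms(1,2) by (simp add: sends_ENode synced_def pushes_iff heard_def)
  finally show ?thesis using True e by auto
next
  case False
  then show ?thesis unfolding H_nth[OF assms(4)] by simp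
qed

text \<open>The ports of a set correspond bijectively to its elements, so counting ports with a
  message counts elements although nobody has an identifier.\<close>

lemma card_hears:
  assumes "synced t" "t < stages ldeg" "S < n" "2 * t < r"
  shows "card {q. (H r (SNode S) ! (2 * t)) q \<noteq> None} = card (heard \<omega> t (alive \<omega> t) S)"
proof -
  have "bij_betw (\<lambda>e. bport mem n m pn (SNode S) (ENode e)) (heard \<omega> t (alive \<omega> t) S)
     {q. (H r (SNode S) ! (2 * t)) q \<noteq> None}"
    unfolding bij_betw_def
  proof
    have nb: "ENode e \<in> nbrs mem n m (SNode S)" if "e \<in> heard \<omega> t (alive \<omega> t) S" for e
      using that assms(3) by (auto simp: nbrs_SNode heard_def)
    have v: "SNode S \<in> nodes n m" using assms(3) by simp
    show "inj_on (\<lambda>e. bport mem n m pn (SNode S) (ENode e)) (heard \<omega> t (alive \<omega> t) S)"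
      by (rule inj_onI) (metis ex_port(2)[OF v nb] node.inject(2))
    show "(\<lambda>e. bport mem n m pn (SNode S) (ENode e)) ` heard \<omega> t (alive \<omega> t) S =
      {q. (H r (SNode S) ! (2 * t)) q \<noteq> None}" (is "?f ` ?h = ?R")
    proof (intro equalityI subsetI)
      fix q assume "q \<in> ?f ` ?h"
      then show "q \<in> ?R" using hears_iff[OF assms] ex_port[OF v nb] by auto
    next
      fix q assume "q \<in> ?R"
      then have "(H r (SNode S) ! (2 * t)) q \<noteq> None" by simp
      then obtain e where "q < deg mem n m (SNode S)" "e \<in> ?h" "pn (SNode S) q = ENode e"
        using hears_iff[OF assms] by blast
      then show "q \<in> ?f ` ?h" using pn_nbr(2)[OF v, of q] by (intro image_eqI[of _ _ e]) auto
    qed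
  qed
  then show ?thesis using bij_betw_same_card by metis
qed

text \<open>The history length \<open>r\<close> is left open because the condition is evaluated in
  the informing round 2t + 1 and again at the end for the output.\<close>

lemma set_joins_iff:
  assumes "\<And>t'. t' \<le> t \<Longrightarrow> synced t'" "t < stages ldeg" "S < n" "2 * t < r"
  shows "set_joins ldeg half (8 * prec) (tp (SNode S)) (H r (SNode S)) t \<longleftrightarrow> S \<in> joins \<omega> t"
proof -
  have "seems_heavy ldeg half (8 * prec) (H r (SNode S)) t' \<longleftrightarrow> looks_heavy \<omega> t' (alive \<omega> t') S" if "t' \<le> t" for t'
    unfolding seems_heavy_def looks_heavy_def using that assms by (subst card_hears) auto
  moreover have "tp (SNode S) (prod_encode (t, i)) = \<omega> (t, SNode S) i" if "i < ldeg - t mod (ldeg + 1)" for i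
    using that assms(2,3) less_le_trans[OF that diff_le_self] by (simp add: \<omega>_def tape_bits_def)
  ultimately show ?thesis
    using assms(3) unfolding set_joins_def joins_eq by (auto simp: mem_heavy_iff)
qed

text \<open>The neighbours of an element are sets and stay quiet in even rounds, so only round 2t +
  1 can break its silence.\<close>

lemma synced_Suc:
  assumes "\<And>t'. t' \<le> t \<Longrightarrow> synced t'" "t < stages ldeg"
  shows "synced (Suc t)"
  unfolding synced_def
proof (intro allI impI)
  fix e assume e: "e < m"
  have HS: "H (2 * Suc t) (ENode e) = H (2 * t) (ENode e) @
      [H (2 * Suc t) (ENode e) ! (2 * t), H (2 * Suc t) (ENode e) ! (2 * t + 1)]"
    by (simp add: hist.simps nth_append)
  have sender: "\<exists>S. S < n \<and> mem S e \<and> pn (ENode e) q = SNode S" if "q < deg mem n m (ENode e)" for q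
    using pn_nbr(1)[of "ENode e" q] that e by (auto simp: nbrs_ENode)
  have even: "(H (2 * Suc t) (ENode e) ! (2 * t)) q = None" for q
  proof -
    have "\<not> (q < deg mem n m (ENode e) \<and> sends (2 * t) (pn (ENode e) q) (bport mem n m pn (pn (ENode e) q) (ENode e)))"
      using sender[of q] by (auto simp: sends_SNode)
    moreover have "2 * t < 2 * Suc t" by simp
    note H_nth[OF this, of "ENode e" q]
    ultimately show ?thesis by blast
  qed
  have odd: "(\<exists>q. (H (2 * Suc t) (ENode e) ! (2 * t + 1)) q \<noteq> None) \<longleftrightarrow> (\<exists>S\<in>joins \<omega> t. mem S e)"
    if al: "e \<in> alive \<omega> t"
  proof -
    have hears: "sends (2 * t + 1) (SNode S) (bport mem n m pn (SNode S) (ENode e)) \<longleftrightarrow> S \<in> joins \<omega> t"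
      if "S < n" "mem S e" for S
    proof -
      have "ENode e \<in> nbrs mem n m (SNode S)" using that e by (simp add: nbrs_SNode)
      note port = ex_port[OF _ this]
      \<comment> \<open>With zero prescribed bits an uncovered element contacts all its ports, so it
        is among those that a joining set answers.\<close>
      have "(H (2 * t + 1) (SNode S) ! (2 * t)) (bport mem n m pn (SNode S) (ENode e)) \<noteq> None"
        if "\<not> sparse ldeg half (8 * prec) t"
        using that port \<open>S < n\<close> \<open>mem S e\<close> e al assms hears_iff[of t S "2 * t + 1"]
        by (auto simp: heard_dense)
      then show ?thesis
        using set_joins_iff[OF assms that(1), of "2 * t + 1"] by (auto simp: sends_SNode)
    qed
    show ?thesis
    proof
      assume "\<exists>q. (H (2 * Suc t) (ENode e) ! (2 * t + 1)) q \<noteq> None"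
      then obtain q where "q < deg mem n m (ENode e)"
        "sends (2 * t + 1) (pn (ENode e) q) (bport mem n m pn (pn (ENode e) q) (ENode e))"
        by (subst (asm) H_nth) auto
      then show "\<exists>S\<in>joins \<omega> t. mem S e" using sender[of q] hears by metis
    next
      assume "\<exists>S\<in>joins \<omega> t. mem S e"
      then obtain S where S: "S \<in> joins \<omega> t" "mem S e" by auto
      then have "S < n" using joins_subset by auto
      then have "SNode S \<in> nbrs mem n m (ENode e)" using S e by (simp add: nbrs_ENode)
      note port = ex_port[OF _ this]
      have "(H (2 * Suc t) (ENode e) ! (2 * t + 1)) (port e S) \<noteq> None"
        using port hears[OF \<open>S < n\<close> S(2)] S(1) e by (subst H_nth) (simp_all add: port_def)
      then show "\<exists>q. (H (2 * Suc t) (ENode e) ! (2 * t + 1)) q \<noteq> None" by blast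
    qed
  qed
  have "silent (H (2 * Suc t) (ENode e)) \<longleftrightarrow>
      silent (H (2 * t) (ENode e)) \<and> (\<forall>q. (H (2 * Suc t) (ENode e) ! (2 * t + 1)) q = None)"
    unfolding silent_def by (subst HS) (use even in auto)
  also have "\<dots> \<longleftrightarrow> e \<in> alive \<omega> (Suc t)"
    using assms(1)[of t] e odd by (auto simp: synced_def alive_Suc)
  finally show "silent (H (2 * Suc t) (ENode e)) \<longleftrightarrow> e \<in> alive \<omega> (Suc t)" .
qed

lemma synced: "t \<le> stages ldeg \<Longrightarrow> synced t"
proof (induction t rule: less_induct)
  case (less t)
  then show ?case
  proof (cases t)
    case 0
    then show ?thesis by (simp add: synced_def silent_def)
  next
    case (Suc u)
    then show ?thesis using less by (auto intro!: synced_Suc)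
  qed
qed

lemma output_eq_chosen: "output_cover (cover_alg A) mem n m pn L tp = chosen \<omega>"
proof -
  have "outp (cover_alg A) (linp mem n m L (SNode S)) (tp (SNode S))
      (H (rounds (cover_alg A) (maxdeg mem n m) L) (SNode S)) \<longleftrightarrow> (\<exists>t<stages ldeg. S \<in> joins \<omega> t)"
    if "S < n" for S
  proof -
    have "outp (cover_alg A) (linp mem n m L (SNode S)) (tp (SNode S))
      (H (rounds (cover_alg A) (maxdeg mem n m) L) (SNode S)) \<longleftrightarrow>
      (\<exists>t<stages ldeg. set_joins ldeg half (8 * prec) (tp (SNode S)) (H (2 * stages ldeg) (SNode S)) t)"
      using maxdeg_pos by (simp add: cover_alg_def linp_def ldeg_def half_def prec_def Let_def)
    also have "\<dots> \<longleftrightarrow> (\<exists>t<stages ldeg. S \<in> joins \<omega> t)"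
      using synced that by (intro ex_cong conj_cong refl set_joins_iff) auto
    finally show ?thesis .
  qed
  then show ?thesis using joins_subset by (auto simp: output_cover_def chosen_def)
qed

section \<open>Counting messages\<close>

definition slice :: "nat \<Rightarrow> (node \<times> nat) set" where
  "slice r = {(v, p). v \<in> nodes n m \<and> p < deg mem n m v \<and> sends r v p}"

lemma sent_eq_slice: "sent (cover_alg A) mem n m pn L tp = (SIGMA r:{..<2 * stages ldeg}. slice r)"
proof -
  have "rounds (cover_alg A) (maxdeg mem n m) L = 2 * stages ldeg"
    using maxdeg_pos by (simp add: cover_alg_def ldeg_def)
  then show ?thesis unfolding sent_def send_eq by (auto simp: slice_def)
qed

text \<open>With \<open>k\<close> low-order bits fixed, a port is determined by its quotient by 2^k.
  The bound holds for every pattern, so the number of contacts in a sparse stage carries no error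
  probability.\<close>

lemma card_ports_matching:
  "card {p. p < D \<and> (\<forall>i<k. x i = odd (p div 2 ^ i))} \<le> D div 2 ^ k + 1"
proof -
  let ?P = "{p. p < D \<and> (\<forall>i<k. x i = odd (p div 2 ^ i))}"
  have inj: "inj_on (\<lambda>p. p div 2 ^ k) ?P"
  proof (rule inj_onI)
    fix p q assume p: "p \<in> ?P" and q: "q \<in> ?P" and eq: "p div 2 ^ k = q div 2 ^ k"
    have "bit p i = bit q i" if "i < k" for i using p q that by (auto simp: bit_iff_odd)
    then have "take_bit k p = take_bit k q" by (intro bit_eqI) (auto simp: bit_take_bit_iff)
    then have "p mod 2 ^ k = q mod 2 ^ k" by (simp add: take_bit_eq_mod)
    then show "p = q" using eq by (metis div_mult_mod_eq)
  qed
  have "(\<lambda>p. p div 2 ^ k) ` ?P \<subseteq> {..D div 2 ^ k}" by (auto intro!: div_le_mono)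
  then have "card ((\<lambda>p. p div 2 ^ k) ` ?P) \<le> card {..D div 2 ^ k}" by (intro card_mono) auto
  then show ?thesis by (simp add: card_image[OF inj])
qed

text \<open>The first summand covers sparse stages, with 2 for the contacts by elements and
  \<open>4 * K\<close> for the announcements of joining sets; the second covers dense
  stages.\<close>

definition round_bound :: "nat \<Rightarrow> nat" where
  "round_bound K = (4 * K + 2) * m * 2 ^ (ldeg - half) + 2 * n * (8 * prec * 2 ^ half)"

lemma card_Sigma_image_le:
  assumes "finite I" "X \<subseteq> (\<lambda>(i, p). (f i, p)) ` (SIGMA i:I. B i)" "\<And>i. i \<in> I \<Longrightarrow> finite (B i)"
  shows "card X \<le> (\<Sum>i\<in>I. card (B i))"
proof -
  have "card X \<le> card ((\<lambda>(i, p). (f i, p)) ` (SIGMA i:I. B i))" using assms by (intro card_mono) auto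
  also have "\<dots> \<le> card (SIGMA i:I. B i)" using assms by (intro card_image_le) auto
  finally show ?thesis using assms by simp
qed

lemma sum_resid_le:
  assumes "accurate \<omega>" "t < stages ldeg" "\<not> sparse ldeg half (8 * prec) t"
  shows "(\<Sum>S<n. resid \<omega> t S) \<le> 2 * n * (8 * prec * 2 ^ half)"
proof -
  have "(\<Sum>S<n. resid \<omega> t S) \<le> (\<Sum>S<n. 2 * tau ldeg t)"
    using assms by (intro sum_mono resid_le) auto
  also have "\<dots> \<le> (\<Sum>S<n. 2 * (8 * prec * 2 ^ half))"
    using assms(3) by (intro sum_mono mult_left_mono) (auto simp: sparse_def)
  finally show ?thesis by (simp add: ac_simps)
qed

lemma slice_even:
  assumes acc: "accurate \<omega>" and t: "t < stages ldeg"
  shows "card (slice (2 * t)) \<le> round_bound K"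
proof (cases "sparse ldeg half (8 * prec) t")
  case True
  let ?B = "\<lambda>e. {p. p < deg mem n m (ENode e) \<and> (\<forall>i<half. tp (ENode e) (prod_encode (t, i)) = odd (p div 2 ^ i))}"
  have "slice (2 * t) \<subseteq> (\<lambda>(e, p). (ENode e, p)) ` (SIGMA e:{..<m}. ?B e)"
  proof
    fix vp assume "vp \<in> slice (2 * t)"
    then obtain v p where vp: "vp = (v, p)" "v \<in> nodes n m" "p < deg mem n m v" "sends (2 * t) v p"
      by (auto simp: slice_def)
    then obtain e where "v = ENode e" by (cases v) (auto simp: sends_SNode)
    then show "vp \<in> (\<lambda>(e, p). (ENode e, p)) ` (SIGMA e:{..<m}. ?B e)"
      using vp True by (intro image_eqI[of _ _ "(e, p)"]) (auto simp: sends_ENode pushes_def sbits_def)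
  qed
  then have "card (slice (2 * t)) \<le> (\<Sum>e<m. card (?B e))" by (intro card_Sigma_image_le) auto
  also have "\<dots> \<le> (\<Sum>e<m. 2 * 2 ^ (ldeg - half))"
  proof (rule sum_mono)
    fix e assume "e \<in> {..<m}"
    have "card (?B e) \<le> deg mem n m (ENode e) div 2 ^ half + 1" by (rule card_ports_matching)
    also have "\<dots> \<le> 2 ^ ldeg div 2 ^ half + 1"
      using deg_le[of "ENode e"] \<open>e \<in> {..<m}\<close> by (intro add_right_mono div_le_mono) auto
    also have "2 ^ ldeg div 2 ^ half = (2::nat) ^ (ldeg - half)" using b_le by (simp add: power_diff)
    also have "(2::nat) ^ (ldeg - half) + 1 \<le> 2 * 2 ^ (ldeg - half)" by simp
    finally show "card (?B e) \<le> 2 * 2 ^ (ldeg - half)" .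
  qed
  also have "\<dots> \<le> round_bound K" by (simp add: round_bound_def algebra_simps)
  finally show ?thesis .
next
  case False
  have "slice (2 * t) \<subseteq> (\<lambda>(e, p). (ENode e, p)) ` (SIGMA e:alive \<omega> t. {..<deg mem n m (ENode e)})"
  proof
    fix vp assume "vp \<in> slice (2 * t)"
    then obtain v p where vp: "vp = (v, p)" "v \<in> nodes n m" "p < deg mem n m v" "sends (2 * t) v p"
      by (auto simp: slice_def)
    then obtain e where e: "v = ENode e" by (cases v) (auto simp: sends_SNode)
    then have "e \<in> alive \<omega> t" using vp synced[of t] t by (auto simp: sends_ENode synced_def)
    then show "vp \<in> (\<lambda>(e, p). (ENode e, p)) ` (SIGMA e:alive \<omega> t. {..<deg mem n m (ENode e)})"
      using vp e by (intro image_eqI[of _ _ "(e, p)"]) auto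
  qed
  then have "card (slice (2 * t)) \<le> (\<Sum>e\<in>alive \<omega> t. card {..<deg mem n m (ENode e)})"
    by (intro card_Sigma_image_le) auto
  also have "\<dots> = (\<Sum>e\<in>alive \<omega> t. card {S\<in>{..<n}. mem S e})"
    using alive_subset[of \<omega> t] by (intro sum.cong) (auto simp: deg_ENode)
  \<comment> \<open>Edges at uncovered elements are counted from the sets, whose residual degrees
    accuracy keeps small in a dense stage.\<close>
  also have "\<dots> = (\<Sum>S<n. resid \<omega> t S)"
    unfolding resid_def by (rule sum_multicount_gen) auto
  also have "\<dots> \<le> round_bound K"
    using sum_resid_le[OF acc t False] by (simp add: round_bound_def)
  finally show ?thesis .
qed

lemma slice_odd:
  assumes acc: "accurate \<omega>" and t: "t < stages ldeg"
    and hits: "\<And>e. e \<in> alive \<omega> t \<Longrightarrow> hits \<omega> t e \<le> K"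
  shows "card (slice (2 * t + 1)) \<le> round_bound K"
proof -
  have sender: "\<exists>S\<in>joins \<omega> t. v = SNode S \<and> p < deg mem n m (SNode S) \<and>
      (sparse ldeg half (8 * prec) t \<or> (H (2 * t + 1) (SNode S) ! (2 * t)) p \<noteq> None)"
    if "(v, p) \<in> slice (2 * t + 1)" for v p
  proof -
    have vp: "v \<in> nodes n m" "p < deg mem n m v" "sends (2 * t + 1) v p"
      using that by (auto simp: slice_def)
    then obtain S where S: "v = SNode S" by (cases v) (auto simp: sends_ENode)
    have "synced t'" if "t' \<le> t" for t' using that t by (intro synced) simp
    then show ?thesis using vp S t set_joins_iff[of t S "2 * t + 1"] by (auto simp: sends_SNode)
  qed
  show ?thesis
  proof (cases "sparse ldeg half (8 * prec) t")
    case True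
    have "slice (2 * t + 1) \<subseteq> (\<lambda>(S, p). (SNode S, p)) ` (SIGMA S:joins \<omega> t. {..<2 ^ ldeg})"
    proof
      fix vp assume "vp \<in> slice (2 * t + 1)"
      then obtain S p where "vp = (SNode S, p)" "S \<in> joins \<omega> t" "p < deg mem n m (SNode S)"
        using sender by (cases vp) blast
      moreover have "deg mem n m (SNode S) \<le> 2 ^ ldeg"
        using \<open>S \<in> joins \<omega> t\<close> joins_subset by (intro deg_le) auto
      ultimately show "vp \<in> (\<lambda>(S, p). (SNode S, p)) ` (SIGMA S:joins \<omega> t. {..<2 ^ ldeg})"
        by (intro image_eqI[of _ _ "(S, p)"]) auto
    qed
    then have "card (slice (2 * t + 1)) \<le> (\<Sum>S\<in>joins \<omega> t. card {..<(2::nat) ^ ldeg})"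
      by (intro card_Sigma_image_le) auto
    \<comment> \<open>Splitting 2^ldeg lets \<open>tau\<close>, which is at least 2^half, pay for
      the joining sets, of which there are at most 4 K m / tau.\<close>
    also have "\<dots> = 2 ^ half * card (joins \<omega> t) * 2 ^ (ldeg - half)"
      using b_le by (simp add: power_add[symmetric] ac_simps)
    also have "\<dots> \<le> 4 * (K * m) * 2 ^ (ldeg - half)"
    proof (rule mult_right_mono)
      have "1 * 2 ^ half \<le> 8 * prec * 2 ^ half" using z_pos by (intro mult_right_mono) auto
      also have "\<dots> \<le> tau ldeg t" using True by (simp add: sparse_def)
      finally have "2 ^ half \<le> tau ldeg t" by simp
      then have "2 ^ half * card (joins \<omega> t) \<le> tau ldeg t * card (joins \<omega> t)" by (rule mult_right_mono) simp
      also have "\<dots> \<le> 4 * (\<Sum>e\<in>alive \<omega> t. hits \<omega> t e)" by (rule tau_card_joins_le[OF acc t])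
      also have "\<dots> \<le> 4 * (\<Sum>e\<in>alive \<omega> t. K)" using hits by (intro mult_left_mono sum_mono) auto
      also have "\<dots> \<le> 4 * (K * m)" using card_mono[OF _ alive_subset[of \<omega> t]] by simp
      finally show "2 ^ half * card (joins \<omega> t) \<le> 4 * (K * m)" .
    qed simp
    also have "\<dots> \<le> round_bound K" by (simp add: round_bound_def algebra_simps)
    finally show ?thesis .
  next
    case False
    let ?B = "\<lambda>S. {p. (H (2 * t + 1) (SNode S) ! (2 * t)) p \<noteq> None}"
    have card_B: "finite (?B S)" "card (?B S) \<le> resid \<omega> t S" if "S < n" for S
    proof -
      have "?B S \<subseteq> {..<deg mem n m (SNode S)}"
        using hears_iff[of t S "2 * t + 1"] synced[of t] t that by auto
      then show "finite (?B S)" by (rule finite_subset) simp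
      show "card (?B S) \<le> resid \<omega> t S"
        using synced[of t] t that by (subst card_hears) (auto simp: resid_def heard_def intro!: card_mono)
    qed
    have jn: "S < n" if "S \<in> joins \<omega> t" for S using that joins_subset by blast
    have sub: "slice (2 * t + 1) \<subseteq> (\<lambda>(S, p). (SNode S, p)) ` (SIGMA S:joins \<omega> t. ?B S)"
    proof
      fix vp assume "vp \<in> slice (2 * t + 1)"
      then obtain S p where "vp = (SNode S, p)" "S \<in> joins \<omega> t" "p \<in> ?B S"
        using sender False by (cases vp) blast
      then show "vp \<in> (\<lambda>(S, p). (SNode S, p)) ` (SIGMA S:joins \<omega> t. ?B S)"
        by (intro image_eqI[of _ _ "(S, p)"]) auto
    qed
    have "card (slice (2 * t + 1)) \<le> (\<Sum>S\<in>joins \<omega> t. card (?B S))"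
      by (rule card_Sigma_image_le[OF finite_joins sub card_B(1)[OF jn]])
    also have "\<dots> \<le> (\<Sum>S\<in>joins \<omega> t. resid \<omega> t S)"
      using card_B(2) jn by (intro sum_mono) blast
    also have "\<dots> \<le> (\<Sum>S<n. resid \<omega> t S)"
      using joins_subset by (intro sum_mono2) auto
    also have "\<dots> \<le> round_bound K"
      using sum_resid_le[OF acc t False] by (simp add: round_bound_def)
    finally show ?thesis .
  qed
qed

lemma card_sent_le:
  assumes "accurate \<omega>"
    and "\<And>t e. t < stages ldeg \<Longrightarrow> e \<in> alive \<omega> t \<Longrightarrow> hits \<omega> t e \<le> K"
  shows "card (sent (cover_alg A) mem n m pn L tp) \<le> 2 * stages ldeg * round_bound K"
proof -
  have fin: "finite (slice r)" for r
    by (rule finite_subset[of _ "SIGMA v:nodes n m. {..<deg mem n m v}"])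
       (auto simp: slice_def finite_nodes)
  have slice_le: "card (slice r) \<le> round_bound K" if "r < 2 * stages ldeg" for r
  proof (cases "even r")
    case True
    then obtain t where "r = 2 * t" by blast
    then show ?thesis using slice_even[OF assms(1), of t] that by simp
  next
    case False
    then obtain t where "r = 2 * t + 1" by (auto elim: oddE)
    then show ?thesis using slice_odd[OF assms(1), of t] assms(2) that by simp
  qed
  have "card (sent (cover_alg A) mem n m pn L tp) = (\<Sum>r<2 * stages ldeg. card (slice r))"
    unfolding sent_eq_slice using fin by simp
  also have "\<dots> \<le> (\<Sum>r<2 * stages ldeg. round_bound K)"
    using slice_le by (intro sum_mono) auto
  finally show ?thesis by simp
qed

text \<open>The messages as a function of the finite flips: \<open>slice\<close> refers to histories
  on infinite tapes, whereas the event on the message count must be shown measurable.\<close>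

definition slice_of :: "flips \<Rightarrow> nat \<Rightarrow> (node \<times> nat) set" where
  "slice_of g r = (let t = r div 2 in
     if even r
     then {(ENode e, p) | e p. e \<in> alive g t \<and> p < deg mem n m (ENode e) \<and>
       (\<forall>i<sbits ldeg half (8 * prec) t. g (t, ENode e) i = odd (p div 2 ^ i))}
     else {(SNode S, p) | S p. S \<in> joins g t \<and> p < deg mem n m (SNode S) \<and>
       (sparse ldeg half (8 * prec) t \<or> (\<exists>e\<in>heard g t (alive g t) S. pn (SNode S) p = ENode e))})"

lemma slice_eq_slice_of:
  assumes "r < 2 * stages ldeg"
  shows "slice r = slice_of \<omega> r"
proof (cases "even r")
  case True
  then obtain t where r: "r = 2 * t" by blast
  then have t: "t < stages ldeg" using assms by simp
  have "(v, p) \<in> slice r \<longleftrightarrow> (v, p) \<in> slice_of \<omega> r" for v p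
    using t synced[of t] alive_subset[of \<omega> t]
    by (cases v) (auto simp: r slice_def slice_of_def sends_ENode sends_SNode pushes_iff synced_def)
  then show ?thesis by auto
next
  case False
  then obtain t where r: "r = 2 * t + 1" by (auto elim: oddE)
  then have t: "t < stages ldeg" using assms by simp
  have syn: "synced t'" if "t' \<le> t" for t' using that t by (intro synced) simp
  have "(v, p) \<in> slice r \<longleftrightarrow> (v, p) \<in> slice_of \<omega> r" for v p
  proof (cases v)
    case (SNode S)
    show ?thesis
    proof (cases "S < n")
      case True
      have "set_joins ldeg half (8 * prec) (tp (SNode S)) (H (2 * t + 1) (SNode S)) t \<longleftrightarrow> S \<in> joins \<omega> t"
        by (rule set_joins_iff[OF syn t True]) simp_all
      moreover have "(H (2 * t + 1) (SNode S) ! (2 * t)) p \<noteq> None \<longleftrightarrow>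
          p < deg mem n m (SNode S) \<and> (\<exists>e\<in>heard \<omega> t (alive \<omega> t) S. pn (SNode S) p = ENode e)"
        by (rule hears_iff[OF syn[OF order_refl] t True]) simp
      ultimately have "cover_send ldeg half (8 * prec) True (tp (SNode S)) (H (2 * t + 1) (SNode S)) p \<longleftrightarrow>
          S \<in> joins \<omega> t \<and> (sparse ldeg half (8 * prec) t \<or>
            p < deg mem n m (SNode S) \<and> (\<exists>e\<in>heard \<omega> t (alive \<omega> t) S. pn (SNode S) p = ENode e))"
        by (simp add: sends_SNode)
      then show ?thesis using SNode True by (simp add: r slice_def slice_of_def Let_def) blast
    next
      case False
      then show ?thesis using SNode joins_subset by (auto simp: r slice_def slice_of_def)
    qed
  next
    case (ENode e)
    then show ?thesis by (auto simp: r slice_def slice_of_def sends_ENode)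
  qed
  then show ?thesis by auto
qed

lemma sent_eq_slice_of:
  "sent (cover_alg A) mem n m pn L tp = (SIGMA r:{..<2 * stages ldeg}. slice_of \<omega> r)"
  unfolding sent_eq_slice by (intro Sigma_cong slice_eq_slice_of) auto

end

section \<open>The bounds\<close>

lemma maxdeg_le: "maxdeg mem n m \<le> n + m"
proof -
  have "deg mem n m v \<le> n + m" if "v \<in> nodes n m" for v
  proof (cases v)
    case (SNode S)
    then have "deg mem n m v = card {e. e < m \<and> mem S e}" using that by (simp add: deg_SNode)
    also have "\<dots> \<le> card {..<m}" by (intro card_mono) auto
    finally show ?thesis by simp
  next
    case (ENode e)
    then have "deg mem n m v = card {S. S < n \<and> mem S e}" using that by (simp add: deg_ENode)
    also have "\<dots> \<le> card {..<n}" by (intro card_mono) auto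
    finally show ?thesis by simp
  qed
  moreover have "SNode 0 \<in> nodes n m" using n_pos by simp
  then have "nodes n m \<noteq> {}" by blast
  ultimately show ?thesis unfolding maxdeg_def using finite_nodes by (subst Max_le_iff) auto
qed

lemma m_pos: "0 < m"
proof (rule ccontr)
  assume "\<not> 0 < m"
  then have empty: "{e. e < m \<and> P e} = {}" for P by auto
  have "deg mem n m v = 0" if "v \<in> nodes n m" for v
  proof (cases v)
    case (SNode S)
    then have "deg mem n m v = card {e. e < m \<and> mem S e}" using that by (simp add: deg_SNode)
    then show ?thesis unfolding empty by simp
  next
    case (ENode e)
    then have "e < m" using that by simp
    then show ?thesis using \<open>\<not> 0 < m\<close> by simp
  qed
  moreover have "maxdeg mem n m \<in> deg mem n m ` nodes n m"
    unfolding maxdeg_def using finite_nodes n_pos by (intro Max_in) (auto simp: nodes_def)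
  ultimately show False using maxdeg_pos by auto
qed

abbreviation lg :: real where "lg \<equiv> log 2 (real (maxdeg mem n m) + 1)"

lemma lg_ge_1: "1 \<le> lg"
  using maxdeg_pos by (simp add: le_log_iff)

lemma ldeg_le_lg: "real (ldeg + 1) \<le> 3 * lg"
proof -
  have "log 2 (real (maxdeg mem n m)) \<le> lg" using maxdeg_pos by simp
  then show ?thesis using logdeg_le[OF maxdeg_pos] lg_ge_1
    unfolding ldeg_def of_nat_add of_nat_1 by linarith
qed

lemma rounds_le: "real (rounds (cover_alg A) (maxdeg mem n m) L) \<le> 18 * lg\<^sup>2"
proof -
  have "real (rounds (cover_alg A) (maxdeg mem n m) L) = 2 * (real (ldeg + 1))\<^sup>2"
    using maxdeg_pos unfolding real_stages[symmetric] by (simp add: cover_alg_def ldeg_def)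
  also have "\<dots> \<le> 2 * (3 * lg)\<^sup>2" using ldeg_le_lg by (intro mult_left_mono power_mono) auto
  finally show ?thesis by (simp add: power_mult_distrib)
qed

lemma output_is_cover: "is_cover mem n m (output_cover (cover_alg A) mem n m pn L tp)"
  unfolding output_eq_chosen by (rule chosen_cover[OF sparse_tau])

lemma prob_not_accurate:
  assumes "real n + 1 \<le> 2 ^ (A * L)"
  shows "measure_pmf.prob flip_space {g. \<not> accurate g} \<le> 1 / (2 * (real n + 1))"
proof -
  have d: "real (ldeg + 1) \<le> 2 ^ ldeg"
    using Suc_le_two_power[of ldeg] by (metis of_nat_le_iff of_nat_numeral of_nat_power)
  have "2 * real n * real (stages ldeg) * (2 * (real n + 1)) \<le> 2 * (real n + 1) * real (stages ldeg) * (2 * (real n + 1))"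
    by (intro mult_right_mono mult_left_mono) auto
  also have "\<dots> = 4 * (real n + 1)\<^sup>2 * (real (ldeg + 1))\<^sup>2"
  proof -
    have "2 * x * s * (2 * x) = 4 * x\<^sup>2 * s" for x s :: real by (simp add: power2_eq_square)
    then show ?thesis unfolding real_stages .
  qed
  also have "\<dots> \<le> 16 * (2 ^ (A * L))\<^sup>2 * (2 ^ ldeg)\<^sup>2"
    using assms d by (intro mult_mono power_mono) auto
  also have "\<dots> = 2 ^ prec"
    by (simp add: prec_def slack_def power_mult[symmetric] power_add[symmetric] ac_simps)
  finally have "2 * real n * real (stages ldeg) * (2 * (real n + 1)) \<le> 2 ^ prec" .
  then have "2 * real n * real (stages ldeg) * (1/2) ^ prec \<le> 1 / (2 * (real n + 1))"
    by (simp add: field_simps power_one_over)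
  then show ?thesis using prob_inaccurate by linarith
qed

text \<open>Inaccurate runs add less than 1, which is at most the optimum because there is an
  element to cover; hence 33 instead of 32, and 99 = 33 * 3 by \<open>ldeg_le_lg\<close>.\<close>

lemma expected_output:
  assumes "real n + 1 \<le> 2 ^ (A * L)"
  shows "(\<integral>tp. real (card (output_cover (cover_alg A) mem n m pn L tp)) \<partial>coins (nodes n m))
    \<le> 99 * lg * real (opt_cover mem n m)"
proof -
  obtain C where C: "is_cover mem n m C" "card C = opt_cover mem n m"
    using obtain_opt_cover[OF output_is_cover] .
  have "C \<noteq> {}" using C(1) m_pos by (auto simp: is_cover_def)
  moreover have "finite C" using C(1) finite_subset[of C "{..<n}"] by (simp add: is_cover_def)
  ultimately have opt: "1 \<le> real (opt_cover mem n m)" using C(2) by (metis One_nat_def Suc_leI card_gt_0_iff of_nat_1 of_nat_le_iff)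
  have "(\<integral>tp. real (card (output_cover (cover_alg A) mem n m pn L tp)) \<partial>coins (nodes n m))
    = measure_pmf.expectation flip_space (\<lambda>g. real (card (chosen g)))"
    unfolding output_eq_chosen \<omega>_def by (rule integral_tape_bits[OF finite_nodes])
  also have "\<dots> \<le> 32 * real (ldeg + 1) * real (card C) + real n * measure_pmf.prob flip_space {g. \<not> accurate g}"
    by (rule expected_chosen[OF C(1)])
  also have "real n * measure_pmf.prob flip_space {g. \<not> accurate g} \<le> real n * (1 / (2 * (real n + 1)))"
    by (intro mult_left_mono prob_not_accurate assms) auto
  also have "\<dots> \<le> 1 * 1" by (simp add: field_simps)
  also have "\<dots> \<le> real (ldeg + 1) * real (opt_cover mem n m)" using opt by (intro mult_mono) auto
  finally have "(\<integral>tp. real (card (output_cover (cover_alg A) mem n m pn L tp)) \<partial>coins (nodes n m))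
      \<le> 33 * real (ldeg + 1) * real (opt_cover mem n m)" by (simp add: C(2) algebra_simps)
  also have "\<dots> \<le> 33 * (3 * lg) * real (opt_cover mem n m)"
    using ldeg_le_lg by (intro mult_right_mono mult_left_mono) auto
  finally show ?thesis by simp
qed

lemma measurable_output:
  "(\<lambda>tp. real (card (output_cover (cover_alg A) mem n m pn L tp))) \<in> borel_measurable (coins (nodes n m))"
  unfolding output_eq_chosen \<omega>_def by (rule measurable_tape_bits[OF finite_nodes])

abbreviation lnm :: real where "lnm \<equiv> log 2 (real (n + m) + 1)"

lemma lnm_ge_1: "1 \<le> lnm"
  using n_pos by (simp add: le_log_iff)

lemma lg_le_lnm: "lg \<le> lnm"
  using maxdeg_le by simp

text \<open>Since (3/2)^2 exceeds 2, (3/2)^(6 lnm) is at least the cube of n + m + 1, enough for a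
  Markov bound of order 1/n.\<close>

definition "hit_cap = nat \<lceil>6 * lnm\<rceil>"

lemma hit_cap_le: "real hit_cap \<le> 7 * lnm" and hit_cap_ge: "6 * lnm \<le> real hit_cap"
  unfolding hit_cap_def using lnm_ge_1 by linarith+

lemma prob_hits_cap:
  "measure_pmf.prob flip_space {g. \<exists>t<stages ldeg. \<exists>e\<in>alive g t. hit_cap \<le> hits g t e} \<le> 1 / (2 * (real n + 1))"
proof -
  have pos: "hit_cap > 0" using hit_cap_ge lnm_ge_1 by linarith
  define N where "N = real n + 1 + real m"
  have N: "N = real (n + m) + 1" "N \<ge> 2" using m_pos by (simp_all add: N_def)
  have "N ^ 3 = 2 powr (3 * lnm)"
    using N by (simp add: powr_powr[symmetric] powr_mult_base mult.commute[of 3] powr_numeral)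
  also have "\<dots> \<le> ((3/2) powr 2) powr (3 * lnm)"
    using lnm_ge_1 by (intro powr_mono2) (auto simp: power2_eq_square)
  also have "\<dots> = (3/2) powr (6 * lnm)" by (subst powr_powr) simp
  also have "\<dots> \<le> (3/2) powr (real hit_cap)" using hit_cap_ge by (intro powr_mono) auto
  also have "\<dots> = (3/2) ^ hit_cap" by (simp add: powr_realpow)
  finally have pow: "N ^ 3 \<le> (3/2) ^ hit_cap" .
  \<comment> \<open>The inequality of arithmetic and geometric means for \<open>m\<close> and
    \<open>n + 1\<close>.\<close>
  have "4 * real m * (real n + 1) \<le> N\<^sup>2"
    using zero_le_power2[of "real n + 1 - real m"] by (simp add: N_def power2_eq_square algebra_simps)
  moreover have "N\<^sup>2 + 1 \<le> 2 * N\<^sup>2" using one_le_power[of N 2] N(2) by simp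
  moreover have "2 * N\<^sup>2 \<le> N ^ 3" using mult_right_mono[OF N(2), of "N\<^sup>2"] by (simp add: power3_eq_cube power2_eq_square)
  ultimately have key: "4 * real m * (real n + 1) \<le> (3/2) ^ hit_cap - 1" using pow by linarith
  moreover have "0 < 4 * real m * (real n + 1)" using m_pos by simp
  ultimately have gt: "0 < (3/2::real) ^ hit_cap - 1" by linarith
  have "2 * real m / ((3/2) ^ hit_cap - 1) \<le> 1 / (2 * (real n + 1))"
    using gt key by (simp add: field_simps)
  then show ?thesis using prob_many_hits[OF pos] by linarith
qed

lemma round_bound_le:
  assumes "real L \<le> \<alpha> * log 2 (real n + 1)" "0 \<le> \<alpha>"
  shows "real (round_bound hit_cap) \<le> (320 + 64 * real A * \<alpha>) * lnm * sqrt (real (maxdeg mem n m)) * real (n + m)"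
proof -
  let ?s = "sqrt (real (maxdeg mem n m))"
  \<comment> \<open>This serves both exponents, \<open>half\<close> and \<open>ldeg - half\<close>:
    each is at most (ldeg + 1) / 2, and 2^ldeg \<le> 2 \<Delta>.\<close>
  have two_pow: "(2::real) ^ k \<le> 2 * ?s" if "2 * k \<le> ldeg + 1" for k
  proof (rule power2_le_imp_le)
    have "((2::real) ^ k)\<^sup>2 \<le> 2 ^ (ldeg + 1)"
      using that by (simp add: power_mult[symmetric] mult.commute power_increasing del: power_Suc)
    also have "\<dots> \<le> 4 * real (maxdeg mem n m)"
      using two_power_logdeg_le[OF maxdeg_pos] by (simp add: ldeg_def)
    finally show "((2::real) ^ k)\<^sup>2 \<le> (2 * ?s)\<^sup>2" by (simp add: power_mult_distrib)
  qed simp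
  have K: "real (4 * hit_cap + 2) \<le> 30 * lnm"
  proof -
    have "real (4 * hit_cap + 2) = 4 * real hit_cap + 2" by simp
    then show ?thesis using hit_cap_le lnm_ge_1 by linarith
  qed
  have "real L \<le> \<alpha> * lnm"
    using assms n_pos by (elim order_trans) (intro mult_left_mono; simp)
  then have "real A * real L \<le> real A * (\<alpha> * lnm)" by (intro mult_left_mono) auto
  moreover have "real ldeg + 2 \<le> 4 * lnm"
    using ldeg_le_lg lg_le_lnm lnm_ge_1 unfolding of_nat_add of_nat_1 by linarith
  ultimately have z: "real prec \<le> (2 * real A * \<alpha> + 8) * lnm"
    by (simp add: prec_def slack_def algebra_simps)
  have "real (round_bound hit_cap) = real (4 * hit_cap + 2) * real m * 2 ^ (ldeg - half) + 16 * real n * (real prec * 2 ^ half)"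
    by (simp add: round_bound_def algebra_simps)
  also have "\<dots> \<le> 30 * lnm * real m * (2 * ?s) + 16 * real n * ((2 * real A * \<alpha> + 8) * lnm * (2 * ?s))"
    using K z assms(2) lnm_ge_1 by (intro add_mono mult_mono two_pow) (auto simp: half_def)
  also have "\<dots> = (60 * real m + (64 * real A * \<alpha> + 256) * real n) * (lnm * ?s)"
    by (simp add: algebra_simps)
  also have "\<dots> \<le> ((320 + 64 * real A * \<alpha>) * real (n + m)) * (lnm * ?s)"
  proof (rule mult_right_mono)
    have "60 * real m \<le> (320 + 64 * real A * \<alpha>) * real m"
      "(64 * real A * \<alpha> + 256) * real n \<le> (320 + 64 * real A * \<alpha>) * real n"
      using assms(2) by (intro mult_right_mono; simp)+
    then show "60 * real m + (64 * real A * \<alpha> + 256) * real n \<le> (320 + 64 * real A * \<alpha>) * real (n + m)"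
      by (simp add: algebra_simps)
  qed (use lnm_ge_1 in simp)
  finally show ?thesis by (simp add: ac_simps)
qed

text \<open>Of the three logarithms two come from the number of stages and one from
  \<open>round_bound\<close>. Each of the two bad events has probability at most 1 / (2 (n +
  1)).\<close>

lemma prob_few_messages:
  assumes "real n + 1 \<le> 2 ^ (A * L)" "real L \<le> \<alpha> * log 2 (real n + 1)" "0 \<le> \<alpha>"
    and c: "18 * (320 + 64 * real A * \<alpha>) \<le> c"
  shows "1 - 1 / real n \<le> measure (coins (nodes n m)) {tp \<in> space (coins (nodes n m)).
    real (card (sent (cover_alg A) mem n m pn L tp))
      \<le> c * sqrt (real (maxdeg mem n m)) * real (n + m) * lnm ^ 3}"
proof -
  let ?s = "sqrt (real (maxdeg mem n m))"
  let ?N = "c * ?s * real (n + m) * lnm ^ 3"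
  have "real (stages ldeg) = (real (ldeg + 1))\<^sup>2" by (rule real_stages)
  also have "\<dots> \<le> (3 * lnm)\<^sup>2"
  proof (rule power_mono)
    show "real (ldeg + 1) \<le> 3 * lnm" using ldeg_le_lg lg_le_lnm by linarith
  qed simp
  finally have stages: "real (stages ldeg) \<le> 9 * lnm\<^sup>2" by (simp add: power_mult_distrib)
  have total: "real (2 * stages ldeg * round_bound hit_cap) \<le> ?N"
  proof -
    have "real (2 * stages ldeg * round_bound hit_cap) = 2 * real (stages ldeg) * real (round_bound hit_cap)"
      by simp
    also have "\<dots> \<le> 2 * (9 * lnm\<^sup>2) * ((320 + 64 * real A * \<alpha>) * lnm * ?s * real (n + m))"
      using stages by (intro mult_mono round_bound_le assms) auto
    also have "\<dots> = (18 * (320 + 64 * real A * \<alpha>)) * (?s * real (n + m) * lnm ^ 3)"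
      by (simp add: power3_eq_cube power2_eq_square ac_simps)
    also have "\<dots> \<le> c * (?s * real (n + m) * lnm ^ 3)"
      using c lnm_ge_1 by (intro mult_right_mono) auto
    finally show ?thesis by (simp only: mult.assoc)
  qed
  define few where "few g \<longleftrightarrow> real (card (SIGMA r:{..<2 * stages ldeg}. slice_of g r)) \<le> ?N" for g
  let ?B1 = "{g. \<not> accurate g}"
    and ?B2 = "{g. \<exists>t<stages ldeg. \<exists>e\<in>alive g t. hit_cap \<le> hits g t e}"
  let ?r = "tape_bits (stages ldeg) ldeg (nodes n m)"
  have few: "few (?r tp)" if "?r tp \<notin> ?B1 \<union> ?B2" for tp
  proof -
    have "card (sent (cover_alg A) mem n m pn L tp) \<le> 2 * stages ldeg * round_bound hit_cap"
      using that by (intro card_sent_le) (auto simp: \<omega>_def not_le intro: less_imp_le)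
    then have "real (card (sent (cover_alg A) mem n m pn L tp)) \<le> ?N"
      using total by (meson of_nat_le_iff order_trans)
    then show ?thesis by (simp add: few_def sent_eq_slice_of \<omega>_def)
  qed
  let ?M = "coins (nodes n m)"
  have "1 - (1 / (2 * (real n + 1)) + 1 / (2 * (real n + 1))) \<le>
      1 - (measure_pmf.prob flip_space ?B1 + measure_pmf.prob flip_space ?B2)"
    using prob_not_accurate[OF assms(1)] prob_hits_cap by linarith
  also have "\<dots> \<le> 1 - measure_pmf.prob flip_space (?B1 \<union> ?B2)"
    using measure_Un_le[of ?B1 flip_space ?B2] by simp
  also have "\<dots> = measure_pmf.prob flip_space {g. g \<notin> ?B1 \<union> ?B2}"
    using measure_pmf.prob_compl[of "?B1 \<union> ?B2" flip_space] by (simp add: Compl_eq_Diff_UNIV[symmetric] Compl_eq)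
  also have "\<dots> = measure ?M {tp \<in> space ?M. ?r tp \<notin> ?B1 \<union> ?B2}"
    by (rule measure_tape_bits[OF finite_nodes, symmetric])
  also have "\<dots> \<le> measure ?M {tp \<in> space ?M. few (?r tp)}"
  proof -
    have "prob_space ?M" unfolding coins_def
      by (intro prob_space_PiM measure_pmf.prob_space_axioms)
    then interpret prob_space ?M .
    \<comment> \<open>Monotonicity of the measure requires the larger event to be measurable, which
      holds because \<open>few\<close> reads only the finite flips.\<close>
    have "{tp \<in> space ?M. few (?r tp)} = ?r -` {g. few g} \<inter> space ?M" by auto
    also have "\<dots> \<in> sets ?M"
      by (rule measurable_sets[OF distr_tape_bits(1)[OF finite_nodes]]) simp
    finally show ?thesis using few by (intro finite_measure_mono) auto
  qed
  also have "{tp \<in> space ?M. few (?r tp)} =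
      {tp \<in> space ?M. real (card (sent (cover_alg A) mem n m pn L tp)) \<le> ?N}"
    by (simp add: few_def sent_eq_slice_of \<omega>_def)
  finally have "1 - (1 / (2 * (real n + 1)) + 1 / (2 * (real n + 1))) \<le>
    measure ?M {tp \<in> space ?M. real (card (sent (cover_alg A) mem n m pn L tp)) \<le> ?N}" .
  moreover have "1 / (2 * (real n + 1)) + 1 / (2 * (real n + 1)) \<le> 1 / real n"
    using n_pos by (simp add: field_simps)
  ultimately show ?thesis by linarith
qed

end

section \<open>Message size, the case \<Delta> = 0, and assembly of the bounds\<close>

lemma send_cover_alg_Nil: "send (cover_alg A) i x h p = Some b \<Longrightarrow> b = []"
  by (auto simp: cover_alg_def Let_def split: prod.splits if_splits)

lemma msg_size_ok_cover_alg: "0 \<le> c \<Longrightarrow> msg_size_ok (cover_alg A) mem n m pn L c"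
  unfolding msg_size_ok_def by (auto dest!: send_cover_alg_Nil)

lemma no_elements_if_maxdeg_0:
  assumes "maxdeg mem n m = 0" "\<forall>j<m. \<exists>i<n. mem i j"
  shows "m = 0"
proof (rule ccontr)
  assume "m \<noteq> 0"
  then obtain i where i: "i < n" "mem i 0" using assms(2) by auto
  have fin: "finite (nodes n m)" by (simp add: nodes_def)
  have sub: "nbrs mem n m (ENode 0) \<subseteq> nodes n m"
  proof
    fix u assume "u \<in> nbrs mem n m (ENode 0)"
    then show "u \<in> nodes n m" by (cases u) (auto simp: nbrs_def nodes_def)
  qed
  have "SNode i \<in> nbrs mem n m (ENode 0)" using i \<open>m \<noteq> 0\<close> by (simp add: nbrs_def)
  then have "0 < deg mem n m (ENode 0)"
    using finite_subset[OF sub fin] unfolding deg_def by (auto simp: card_gt_0_iff)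
  also have "deg mem n m (ENode 0) \<le> maxdeg mem n m"
    unfolding maxdeg_def using fin \<open>m \<noteq> 0\<close> by (intro Max_ge) (auto simp: nodes_def)
  finally show False using assms(1) by simp
qed

theorem theorem2:
  fixes \<alpha> :: real
  assumes "\<alpha> \<ge> 1"
  shows "\<exists>(A::alg) (c::real) (k::nat) (c0::real). c > 0 \<and> c0 > 0 \<and>
    (\<forall>(n::nat) (m::nat) (mem::nat \<Rightarrow> nat \<Rightarrow> bool) (pn::node \<Rightarrow> nat \<Rightarrow> node) (L::nat).
       n \<ge> 1 \<and> (\<forall>j<m. \<exists>i<n. mem i j) \<and> port_numbering mem n m pn \<and>
       log 2 (real n + 1) \<le> \<alpha> * real L \<and> real L \<le> \<alpha> * log 2 (real n + 1)
     \<longrightarrow>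
       (let \<Delta> = maxdeg mem n m; M = coins (nodes n m);
            cov = output_cover A mem n m pn L in
          real (rounds A \<Delta> L) \<le> c * (log 2 (real \<Delta> + 1))\<^sup>2
        \<and> msg_size_ok A mem n m pn L c
        \<and> (AE tp in M. is_cover mem n m (cov tp))
        \<and> (\<lambda>tp. real (card (cov tp))) \<in> borel_measurable M
        \<and> (\<integral>tp. real (card (cov tp)) \<partial>M)
              \<le> c * log 2 (real \<Delta> + 1) * real (opt_cover mem n m)
        \<and> measure M {tp \<in> space M. real (card (sent A mem n m pn L tp))
              \<le> c * sqrt (real \<Delta>) * real (n + m) * (log 2 (real (n + m) + 1)) ^ k}
            \<ge> 1 - 1 / real n powr c0))"
proof -
  \<comment> \<open>Rounding \<alpha> up makes \<open>A * L\<close> an integer upper bound on the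
    logarithm of n + 1 that every node can compute.\<close>
  define A where "A = nat \<lceil>\<alpha>\<rceil>"
  define c where "c = 18 * (320 + 64 * real A * \<alpha>)"
  have c_ge: "99 \<le> c" using assms by (simp add: c_def)
  show ?thesis
  proof (rule exI[of _ "cover_alg A"], rule exI[of _ c], rule exI[of _ 3], rule exI[of _ 1],
      intro conjI allI impI)
    show "0 < c" using c_ge by simp
    show "(0::real) < 1" by simp
    fix n m :: nat and mem :: "nat \<Rightarrow> nat \<Rightarrow> bool" and pn :: "node \<Rightarrow> nat \<Rightarrow> node" and L :: nat
    assume *: "n \<ge> 1 \<and> (\<forall>j<m. \<exists>i<n. mem i j) \<and> port_numbering mem n m pn \<and>
       log 2 (real n + 1) \<le> \<alpha> * real L \<and> real L \<le> \<alpha> * log 2 (real n + 1)"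
    let ?A = "cover_alg A" and ?M = "coins (nodes n m)"
    have size: "msg_size_ok ?A mem n m pn L c" using c_ge by (intro msg_size_ok_cover_alg) simp
    show "let \<Delta> = maxdeg mem n m; M = coins (nodes n m);
            cov = output_cover (cover_alg A) mem n m pn L in
          real (rounds (cover_alg A) \<Delta> L) \<le> c * (log 2 (real \<Delta> + 1))\<^sup>2
        \<and> msg_size_ok (cover_alg A) mem n m pn L c
        \<and> (AE tp in M. is_cover mem n m (cov tp))
        \<and> (\<lambda>tp. real (card (cov tp))) \<in> borel_measurable M
        \<and> (\<integral>tp. real (card (cov tp)) \<partial>M)
              \<le> c * log 2 (real \<Delta> + 1) * real (opt_cover mem n m)
        \<and> measure M {tp \<in> space M. real (card (sent (cover_alg A) mem n m pn L tp))
              \<le> c * sqrt (real \<Delta>) * real (n + m) * (log 2 (real (n + m) + 1)) ^ 3}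
            \<ge> 1 - 1 / real n powr 1"
    proof (cases "maxdeg mem n m = 0")
      case True
      \<comment> \<open>Without edges there are no elements, as each of them lies in some set: the
        empty output is a cover and all costs are 0.\<close>
      then have m0: "m = 0" using no_elements_if_maxdeg_0 * by blast
      have cov: "output_cover ?A mem n m pn L tp = {}" for tp
        using True by (simp add: output_cover_def cover_alg_def linp_def Let_def)
      have sent: "sent ?A mem n m pn L tp = {}" for tp
        using True by (simp add: sent_def cover_alg_def)
      interpret prob_space ?M unfolding coins_def
        by (intro prob_space_PiM measure_pmf.prob_space_axioms)
      have "is_cover mem n m {}" using m0 by (simp add: is_cover_def)
      then show ?thesis using True size
        by (simp add: cov sent prob_space) (simp add: cover_alg_def)
    next
      case False
      interpret cover_network n m mem pn L A
        using * False by unfold_locales auto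
      have "log 2 (real n + 1) \<le> real (A * L)"
      proof -
        have "\<alpha> \<le> real A" unfolding A_def by linarith
        then have "\<alpha> * real L \<le> real A * real L" by (intro mult_right_mono) auto
        then show ?thesis using * by simp
      qed
      then have "real n + 1 \<le> 2 powr real (A * L)" by (simp add: log_le_iff)
      then have n_le: "real n + 1 \<le> 2 ^ (A * L)" by (simp only: powr_realpow[of 2 "A * L"] zero_less_numeral)
      have "18 * lg\<^sup>2 \<le> c * lg\<^sup>2" using c_ge by (intro mult_right_mono) auto
      then have rounds: "real (rounds ?A (maxdeg mem n m) L) \<le> c * lg\<^sup>2"
        using rounds_le by linarith
      have "99 * lg * real (opt_cover mem n m) \<le> c * lg * real (opt_cover mem n m)"
        using c_ge lg_ge_1 by (intro mult_right_mono) auto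
      then have ratio: "(\<integral>tp. real (card (output_cover ?A mem n m pn L tp)) \<partial>?M) \<le> c * lg * real (opt_cover mem n m)"
        using expected_output[OF n_le] by linarith
      have "1 - 1 / real n \<le> measure ?M {tp \<in> space ?M.
          real (card (sent ?A mem n m pn L tp)) \<le> c * sqrt (real (maxdeg mem n m)) * real (n + m) * lnm ^ 3}"
        using * assms n_le by (intro prob_few_messages[of \<alpha>]) (auto simp: c_def)
      then show ?thesis
        unfolding Let_def using rounds size output_is_cover measurable_output ratio n_pos by simp
    qed
  qed
qed

end
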